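(* Let $X=\mathbb{R}^d$ and $\mathcal F=\mathscr H+\mathcal E_G-\mathcal E_H$ on $\mathcal P_2(X)$, and suppose the standing assumptions (i)--(iv) of the context hold with constant $\eta_0>0$. Suppose in addition that $H\in C^2(X)$ and that the Hessian of $H$ is uniformly bounded on $X$. Let $0<\eta<\eta_0$, let $\mu_0\in\mathcal P_{2,\mathrm{abs}}(X)$, and let $(\mu_n)_{n\ge 0}$ be a sequence produced by the semi Forward-Backward Euler scheme $$\nu_{n+1}=(I+\eta\nabla H)_{\#}\mu_n,\qquad \mu_{n+1}\in \mathrm{JKO}_{\eta(\mathcal E_G+\mathscr H)}(\nu_{n+1}),\qquad n\ge 0.$$ Then, as $N\to\infty$, $$\min_{1\le n\le N}\mathrm{dist}\big(0,\partial_F^-\mathcal F(\mu_n)\big)=O\big(N^{-1/2}\big),$$ where $\mathrm{dist}(0,\partial_F^-\mathcal F(\mu)):=\inf_{\xi\in\partial_F^-\mathcal F(\mu)}\|\xi\|_{L^2(X,X,\mu)}$.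
   Context: $X=\mathbb R^d$. $\mathcal P_2(X)$ is the set of Borel probability measures on $X$ with finite second moment, $W_2$ the 2-Wasserstein distance on it, and $\mathcal P_{2,\mathrm{abs}}(X)\subset\mathcal P_2(X)$ the subset of measures absolutely continuous with respect to Lebesgue measure. $\Gamma_o(\mu,\nu)$ is the set of optimal transport plans between $\mu$ and $\nu$ for the cost $\|x-y\|^2$. For $\mu\in\mathcal P_{2,\mathrm{abs}}(X)$ and $\nu\in\mathcal P_2(X)$, $T_\mu^\nu$ is the ($\mu$-a.e. unique) optimal transport map from $\mu$ to $\nu$. $T_\#\mu$ is the pushforward, $I$ the identity map, and $L^2(X,X,\mu)$ the Hilbert space of Borel maps $\xi:X\to X$ with norm $\|\xi\|_{L^2(X,X,\mu)}=(\int\|\xi\|^2d\mu)^{1/2}<\infty$. A function $f:X\to\mathbb R$ has quadratic growth if there is $a>0$ with $|f(x)|\le a(\|x\|^2+1)$ for all $x$. For such $f$, $\mathcal E_f(\mu):=\int f\,d\mu$ for $\mu\in\mathcal P_2(X)$. For $\phi:\mathcal P_2(X)\to\mathbb R\cup\{+\infty\}$: $\mathrm{dom}(\phi)=\{\mu:\phi(\mu)<+\infty\}$; $\phi$ is proper if $\mathrm{dom}(\phi)\ne\emptyset$; $\phi$ is l.s.c. if $\liminf_n\phi(\mu_n)\ge\phi(\mu)$ whenever $W_2(\mu_n,\mu)\to0$; $\phi$ is convex along generalized geodesics if for all $\mu,\pi\in\mathcal P_2(X)$, $\nu\in\mathcal P_{2,\mathrm{abs}}(X)$, $t\in[0,1]$,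 $\phi((tT_\nu^\mu+(1-t)T_\nu^\pi)_\#\nu)\le t\phi(\mu)+(1-t)\phi(\pi)$. Fréchet subdifferential: for $\mu\in\mathrm{dom}(\phi)$, $\xi\in L^2(X,X,\mu)$ belongs to $\partial_F^-\phi(\mu)$ if for all $\nu\in\mathcal P_2(X)$, $\phi(\nu)-\phi(\mu)\ge\sup_{\gamma\in\Gamma_o(\mu,\nu)}\int\langle\xi(x),y-x\rangle d\gamma(x,y)+o(W_2(\mu,\nu))$, where $o(s)/s\to0$ as $s\to 0$. JKO operator: $\mathrm{JKO}_{\eta\phi}(\mu):=\arg\min_{\nu\in\mathcal P_2(X)}\phi(\nu)+\frac1{2\eta}W_2^2(\mu,\nu)$ (set of minimizers). Standing assumptions: $F=G-H$ and $\mathcal F(\mu)=\mathcal E_F(\mu)+\mathscr H(\mu)=\mathcal E_G(\mu)-\mathcal E_H(\mu)+\mathscr H(\mu)$, where (i) $\mathcal F$ is bounded below; (ii) $G,H:X\to\mathbb R$ are convex and have quadratic growth; (iii) $\mathscr H:\mathcal P_2(X)\to\mathbb R\cup\{+\infty\}$ is proper, l.s.c., convex along generalized geodesics, and $\mathrm{dom}(\mathscr H)\subset\mathcal P_{2,\mathrm{abs}}(X)$; (iv) there is $\eta_0>0$ such that for all $\eta\in(0,\eta_0)$ and all $\mu\in\mathcal P_2(X)$, $\mathrm{JKO}_{\eta(\mathcal E_G+\mathscr H)}(\mu)\neq\emptyset$. *)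

theory Defs
  imports "HOL-Probability.Probability"
begin

section \<open>Wasserstein space\<close>

definition P2 :: "'a::euclidean_space measure set" where
  "P2 = {\<mu>. prob_space \<mu> \<and> sets \<mu> = sets borel \<and> integrable \<mu> (\<lambda>x. (norm x)\<^sup>2)}"

definition P2_abs :: "'a::euclidean_space measure set" where
  "P2_abs = {\<mu> \<in> P2. absolutely_continuous lborel \<mu>}"

definition couplings ::
  "'a::euclidean_space measure \<Rightarrow> 'a measure \<Rightarrow> ('a \<times> 'a) measure set" where
  "couplings \<mu> \<nu> = {\<gamma>. prob_space \<gamma> \<and> sets \<gamma> = sets borel \<and>
     distr \<gamma> borel fst = \<mu> \<and> distr \<gamma> borel snd = \<nu>}"

text \<open>The Bochner integral below is meaningful for couplings of measures in \<^const>\<open>P2\<close>,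
  for which the integrand is always integrable.\<close>

definition transport_cost :: "('a::euclidean_space \<times> 'a) measure \<Rightarrow> real" where
  "transport_cost \<gamma> = (\<integral>z. (norm (fst z - snd z))\<^sup>2 \<partial>\<gamma>)"

definition W2 :: "'a::euclidean_space measure \<Rightarrow> 'a measure \<Rightarrow> real" where
  "W2 \<mu> \<nu> = sqrt (INF \<gamma> \<in> couplings \<mu> \<nu>. transport_cost \<gamma>)"

definition optimal_plans ::
  "'a::euclidean_space measure \<Rightarrow> 'a measure \<Rightarrow> ('a \<times> 'a) measure set" where
  "optimal_plans \<mu> \<nu> = {\<gamma>. is_arg_min transport_cost (\<lambda>\<gamma>. \<gamma> \<in> couplings \<mu> \<nu>) \<gamma>}"

definition is_optimal_map ::
  "'a::euclidean_space measure \<Rightarrow> 'a measure \<Rightarrow> ('a \<Rightarrow> 'a) \<Rightarrow> bool" where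
  "is_optimal_map \<mu> \<nu> T \<longleftrightarrow> T \<in> borel_measurable borel \<and> distr \<mu> borel T = \<nu> \<and>
     distr \<mu> borel (\<lambda>x. (x, T x)) \<in> optimal_plans \<mu> \<nu>"

definition L2_maps :: "'a::euclidean_space measure \<Rightarrow> ('a \<Rightarrow> 'a) set" where
  "L2_maps \<mu> = {\<xi> \<in> borel_measurable borel. integrable \<mu> (\<lambda>x. (norm (\<xi> x))\<^sup>2)}"

definition L2_norm :: "'a::euclidean_space measure \<Rightarrow> ('a \<Rightarrow> 'a) \<Rightarrow> real" where
  "L2_norm \<mu> \<xi> = sqrt (\<integral>x. (norm (\<xi> x))\<^sup>2 \<partial>\<mu>)"

section \<open>Functions on the underlying space\<close>

definition quadratic_growth :: "('a::euclidean_space \<Rightarrow> real) \<Rightarrow> bool" where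
  "quadratic_growth f \<longleftrightarrow> (\<exists>a>0. \<forall>x. \<bar>f x\<bar> \<le> a * ((norm x)\<^sup>2 + 1))"

definition gradient :: "('a::euclidean_space \<Rightarrow> real) \<Rightarrow> 'a \<Rightarrow> 'a" where
  "gradient f x = (THE D. GDERIV f x :> D)"

text \<open>The Hessian at a point is the derivative of the gradient there, as a bounded linear map
  with the operator norm.\<close>

definition hessian :: "('a::euclidean_space \<Rightarrow> real) \<Rightarrow> 'a \<Rightarrow> 'a \<Rightarrow>\<^sub>L 'a" where
  "hessian f x = Blinfun (frechet_derivative (gradient f) (at x))"

definition C2 :: "('a::euclidean_space \<Rightarrow> real) \<Rightarrow> bool" where
  "C2 f \<longleftrightarrow> (\<forall>x. f differentiable (at x)) \<and> (\<forall>x. gradient f differentiable (at x)) \<and>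
     continuous_on UNIV (hessian f)"

section \<open>Functionals on the Wasserstein space\<close>

text \<open>A functional with values in the reals extended by plus infinity is an \<^typ>\<open>ereal\<close>-valued
  function on all measures. Only its values on \<^const>\<open>P2\<close> matter, and these are assumed to
  differ from minus infinity.\<close>

definition potential_energy ::
  "('a::euclidean_space \<Rightarrow> real) \<Rightarrow> 'a measure \<Rightarrow> ereal" where
  "potential_energy f \<mu> = ereal (\<integral>x. f x \<partial>\<mu>)"

definition never_minus_infinity :: "('a::euclidean_space measure \<Rightarrow> ereal) \<Rightarrow> bool" where
  "never_minus_infinity \<phi> \<longleftrightarrow> (\<forall>\<mu>\<in>P2. \<phi> \<mu> \<noteq> -\<infinity>)"

definition eff_dom :: "('a::euclidean_space measure \<Rightarrow> ereal) \<Rightarrow> 'a measure set" where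
  "eff_dom \<phi> = {\<mu> \<in> P2. \<phi> \<mu> < \<infinity>}"

definition proper :: "('a::euclidean_space measure \<Rightarrow> ereal) \<Rightarrow> bool" where
  "proper \<phi> \<longleftrightarrow> eff_dom \<phi> \<noteq> {}"

definition bounded_below :: "('a::euclidean_space measure \<Rightarrow> ereal) \<Rightarrow> bool" where
  "bounded_below \<phi> \<longleftrightarrow> (\<exists>m::real. \<forall>\<mu>\<in>P2. ereal m \<le> \<phi> \<mu>)"

definition W2_lsc :: "('a::euclidean_space measure \<Rightarrow> ereal) \<Rightarrow> bool" where
  "W2_lsc \<phi> \<longleftrightarrow> (\<forall>\<mu>s \<mu>. (\<forall>n. \<mu>s n \<in> P2) \<longrightarrow> \<mu> \<in> P2 \<longrightarrow> (\<lambda>n. W2 (\<mu>s n) \<mu>) \<longlonglongrightarrow> 0 \<longrightarrow>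
     \<phi> \<mu> \<le> liminf (\<lambda>n. \<phi> (\<mu>s n)))"

text \<open>The optimal map from an absolutely continuous measure is unique almost everywhere, so
  quantifying over all optimal maps amounts to speaking about ``the'' optimal map.\<close>

definition convex_along_generalized_geodesics ::
  "('a::euclidean_space measure \<Rightarrow> ereal) \<Rightarrow> bool" where
  "convex_along_generalized_geodesics \<phi> \<longleftrightarrow>
     (\<forall>\<mu>\<in>P2. \<forall>\<pi>\<in>P2. \<forall>\<nu>\<in>P2_abs. \<forall>t\<in>{0..1}. \<forall>T S.
        is_optimal_map \<nu> \<mu> T \<longrightarrow> is_optimal_map \<nu> \<pi> S \<longrightarrow>
        \<phi> (distr \<nu> borel (\<lambda>x. t *\<^sub>R T x + (1 - t) *\<^sub>R S x))
          \<le> ereal t * \<phi> \<mu> + ereal (1 - t) * \<phi> \<pi>)"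

text \<open>The function \<^term>\<open>r\<close> is the remainder o(s); it may depend on the measure and on the
  subgradient, but on the competitor only through its distance.\<close>

definition frechet_subdiff ::
  "('a::euclidean_space measure \<Rightarrow> ereal) \<Rightarrow> 'a measure \<Rightarrow> ('a \<Rightarrow> 'a) set" where
  "frechet_subdiff \<phi> \<mu> = {\<xi>. \<mu> \<in> eff_dom \<phi> \<and> \<xi> \<in> L2_maps \<mu> \<and>
     (\<exists>r :: real \<Rightarrow> real. ((\<lambda>s. r s / s) \<longlongrightarrow> 0) (at_right 0) \<and>
        (\<forall>\<nu>\<in>P2. \<phi> \<nu> - \<phi> \<mu> \<ge>
           (SUP \<gamma> \<in> optimal_plans \<mu> \<nu>. ereal (\<integral>z. \<xi> (fst z) \<bullet> (snd z - fst z) \<partial>\<gamma>))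
             + ereal (r (W2 \<mu> \<nu>))))}"

text \<open>Extended-real valued: the distance to an empty subdifferential is infinite.\<close>

definition dist_zero_subdiff ::
  "('a::euclidean_space measure \<Rightarrow> ereal) \<Rightarrow> 'a measure \<Rightarrow> ereal" where
  "dist_zero_subdiff \<phi> \<mu> = (INF \<xi> \<in> frechet_subdiff \<phi> \<mu>. ereal (L2_norm \<mu> \<xi>))"

definition JKO ::
  "real \<Rightarrow> ('a::euclidean_space measure \<Rightarrow> ereal) \<Rightarrow> 'a measure \<Rightarrow> 'a measure set" where
  "JKO \<eta> \<phi> \<mu> =
     {\<nu>. is_arg_min (\<lambda>\<nu>. \<phi> \<nu> + ereal (1 / (2 * \<eta>) * (W2 \<mu> \<nu>)\<^sup>2)) (\<lambda>\<nu>. \<nu> \<in> P2) \<nu>}"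

end

theory Submission
  imports Defs
begin

text \<open>
  Let \<open>S = I + \<eta>\<nabla>H\<close>, \<open>\<nu> = S\<^sub>#\<mu>\<^sub>n\<close> and \<open>\<rho> = \<mu>\<^bsub>n+1\<^esub>\<close>. Convexity of \<open>H\<close> makes \<open>S\<close> expanding,
  so a nearly optimal plan between \<open>\<nu>\<close> and \<open>\<rho>\<close> pulls back along \<open>S\<close> to a plan \<open>\<pi>\<close> between \<open>\<mu>\<^sub>n\<close> and
  \<open>\<rho>\<close>. Comparing \<open>\<rho>\<close> with \<open>\<mu>\<^sub>n\<close> in the JKO problem, and using convexity of \<open>H\<close> once more, gives
  \<open>\<integral>\<parallel>x - y\<parallel>\<^sup>2 d\<pi> \<le> 2\<eta> (\<F>(\<mu>\<^sub>n) - \<F>(\<rho>))\<close> up to an arbitrarily small error.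

  A subgradient at \<open>\<rho>\<close> is \<open>\<zeta>(y) = E[S x - y | y] / \<eta> - \<nabla>H(y)\<close>, with \<open>(x, y)\<close> distributed according
  to \<open>\<pi>\<close>: for a competitor \<open>\<sigma>\<close> and a plan from \<open>\<rho>\<close> to \<open>\<sigma>\<close>, gluing the two plans along \<open>\<rho>\<close> bounds
  \<open>W\<^sub>2(\<nu>, \<sigma>)\<^sup>2\<close> from above, and minimality of \<open>\<rho>\<close> turns this bound into the subgradient inequality with
  a quadratic remainder. The norm of \<open>\<zeta>\<close> is at most \<open>(1/\<eta> + L)\<close> times the \<open>L\<^sup>2\<close>-norm of \<open>x - y\<close>, where
  \<open>L\<close> is a Lipschitz constant of \<open>\<nabla>H\<close>. The decrements of \<open>\<F>\<close> telescope, so the smallest of the first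
  \<open>N\<close> is \<open>O(1/N)\<close>.

  Neither optimal maps nor optimal plans nor conditional expectations need to exist: the conditional
  expectation is replaced by averages over small cells, and the exact subgradient is the limit of
  approximate ones, obtained as a point of a decreasing sequence of closed convex sets in \<open>L\<^sup>2(\<rho>)\<close>.
\<close>

section \<open>Square integrable maps and couplings\<close>

text \<open>The domain is an arbitrary measure space, so that one notion serves for maps on the base
  space, functions on plans and functions on the glued measure of two plans.\<close>

definition square_integrable :: "'b measure \<Rightarrow> ('b \<Rightarrow> 'a::euclidean_space) \<Rightarrow> bool" where
  "square_integrable M f \<longleftrightarrow> f \<in> borel_measurable M \<and> integrable M (\<lambda>x. (norm (f x))\<^sup>2)"

lemma square_integrable_measurable [measurable_dest]:
  "square_integrable M f \<Longrightarrow> f \<in> borel_measurable M"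
  by (simp add: square_integrable_def)

lemma square_integrableD: "square_integrable M f \<Longrightarrow> integrable M (\<lambda>x. (norm (f x))\<^sup>2)"
  by (simp add: square_integrable_def)

lemma norm_add_sq_le: "(norm (a + b))\<^sup>2 \<le> 2 * (norm a)\<^sup>2 + 2 * (norm (b::'a::real_inner))\<^sup>2"
proof -
  have "0 \<le> (norm (a - b))\<^sup>2" by simp
  also have "(norm (a - b))\<^sup>2 = 2 * (norm a)\<^sup>2 + 2 * (norm b)\<^sup>2 - (norm (a + b))\<^sup>2"
    by (simp add: power2_norm_eq_inner inner_simps inner_commute)
  finally show ?thesis by simp
qed

lemma abs_inner_le_norm_sq: "\<bar>a \<bullet> b\<bar> \<le> (norm a)\<^sup>2 + (norm (b::'a::real_inner))\<^sup>2"
proof -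
  have "0 \<le> (norm a)\<^sup>2 + (norm b)\<^sup>2" by simp
  moreover have "\<bar>a \<bullet> b\<bar> \<le> norm a * norm b" by (rule Cauchy_Schwarz_ineq2)
  moreover have "2 * (norm a * norm b) \<le> (norm a)\<^sup>2 + (norm b)\<^sup>2"
    using sum_squares_bound[of "norm a" "norm b"] by simp
  ultimately show ?thesis by linarith
qed

lemma square_integrable_bound:
  assumes "f \<in> borel_measurable M" "integrable M h" "\<And>x. (norm (f x))\<^sup>2 \<le> h x"
  shows "square_integrable M f"
  unfolding square_integrable_def
proof (intro conjI assms(1))
  show "integrable M (\<lambda>x. (norm (f x))\<^sup>2)"
    by (rule Bochner_Integration.integrable_bound[OF assms(2)])
      (use assms in \<open>auto intro!: AE_I2 order_trans[OF assms(3)]\<close>)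
qed

lemma square_integrable_add:
  assumes "square_integrable M f" "square_integrable M g"
  shows "square_integrable M (\<lambda>x. f x + g x)"
proof (rule square_integrable_bound)
  show "integrable M (\<lambda>x. 2 * (norm (f x))\<^sup>2 + 2 * (norm (g x))\<^sup>2)"
    using assms by (intro Bochner_Integration.integrable_add integrable_mult_right square_integrableD)
qed (use assms norm_add_sq_le in \<open>auto dest: square_integrable_measurable\<close>)

lemma square_integrable_scaleR:
  "square_integrable M f \<Longrightarrow> square_integrable M (\<lambda>x. c *\<^sub>R f x)"
  by (auto simp: square_integrable_def power_mult_distrib)

lemma square_integrable_diff:
  assumes "square_integrable M f" "square_integrable M g"
  shows "square_integrable M (\<lambda>x. f x - g x)"
  using square_integrable_add[OF assms(1) square_integrable_scaleR[OF assms(2), of "-1"]] by simp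

lemma square_integrable_const:
  "finite_measure M \<Longrightarrow> square_integrable M (\<lambda>_. c)"
  by (simp add: square_integrable_def finite_measure.integrable_const)

lemma square_integrable_inner:
  assumes "square_integrable M f" "square_integrable M g"
  shows "integrable M (\<lambda>x. f x \<bullet> g x)"
proof (rule Bochner_Integration.integrable_bound)
  show "integrable M (\<lambda>x. (norm (f x))\<^sup>2 + (norm (g x))\<^sup>2)"
    using assms by (auto dest: square_integrableD)
  show "AE x in M. norm (f x \<bullet> g x) \<le> norm ((norm (f x))\<^sup>2 + (norm (g x))\<^sup>2)"
    using abs_inner_le_norm_sq by auto
qed (use assms in measurable)

lemma square_integrable_integrable:
  assumes "square_integrable M f" "finite_measure M"
  shows "integrable M f"
proof (rule Bochner_Integration.integrable_bound)
  show "integrable M (\<lambda>x. 1 + (norm (f x))\<^sup>2)"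
    using assms by (intro Bochner_Integration.integrable_add finite_measure.integrable_const square_integrableD)
  have "norm (f x) \<le> 1 + (norm (f x))\<^sup>2" for x
    using sum_squares_bound[of 1 "norm (f x)"] norm_ge_zero[of "f x"] unfolding power_one mult_1_right
    by linarith
  then show "AE x in M. norm (f x) \<le> norm (1 + (norm (f x))\<^sup>2)"
    by (auto intro: AE_I2)
qed (use assms in measurable)

lemma square_integrable_distr:
  assumes [measurable]: "T \<in> measurable M N" "f \<in> borel_measurable N"
  shows "square_integrable (distr M N T) f \<longleftrightarrow> square_integrable M (\<lambda>x. f (T x))"
  unfolding square_integrable_def by (simp add: integrable_distr_eq)

text \<open>A Lipschitz map grows at most linearly: its square is compared with its squared distance
  from the value at 0. This puts the gradient of \<open>H\<close> into \<open>L^2\<close> of every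
  measure in \<open>P2\<close>.\<close>

lemma square_integrable_lipschitz:
  assumes f: "square_integrable M f" and M: "finite_measure M"
    and L: "\<And>x y. norm (g x - g y) \<le> L * norm (x - y)"
    and g [measurable]: "g \<in> borel_measurable borel"
  shows "square_integrable M (\<lambda>x. g (f x))"
proof (rule square_integrable_bound)
  note f [measurable]
  show "(\<lambda>x. g (f x)) \<in> borel_measurable M" by measurable
  show "integrable M (\<lambda>x. 2 * L\<^sup>2 * (norm (f x))\<^sup>2 + 2 * (norm (g 0))\<^sup>2)"
    using f M by (intro Bochner_Integration.integrable_add integrable_mult_right
      finite_measure.integrable_const square_integrableD)
  show "(norm (g (f x)))\<^sup>2 \<le> 2 * L\<^sup>2 * (norm (f x))\<^sup>2 + 2 * (norm (g 0))\<^sup>2" for x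
  proof -
    have "(norm (g (f x) - g 0))\<^sup>2 \<le> (L * norm (f x - 0))\<^sup>2"
      using L[of "f x" 0] by (intro power_mono) auto
    then show ?thesis
      using norm_add_sq_le[of "g (f x) - g 0" "g 0"] by (simp add: power_mult_distrib)
  qed
qed

lemma borel_measurable_cong_borel:
  "sets \<mu> = sets borel \<Longrightarrow> borel_measurable \<mu> = borel_measurable borel"
  by (rule measurable_cong_sets[OF _ refl])

lemma L2_maps_iff:
  assumes "sets \<mu> = sets borel"
  shows "\<xi> \<in> L2_maps \<mu> \<longleftrightarrow> square_integrable \<mu> \<xi>"
  unfolding L2_maps_def square_integrable_def borel_measurable_cong_borel[OF assms] by simp

section \<open>Measures with finite second moment and their couplings\<close>

lemma P2_D:
  assumes "\<mu> \<in> P2"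
  shows "prob_space \<mu>" "sets \<mu> = sets borel" "square_integrable \<mu> (\<lambda>x. x)" "finite_measure \<mu>"
proof -
  show *: "prob_space \<mu>" "sets \<mu> = sets borel" using assms by (auto simp: P2_def)
  then show "finite_measure \<mu>" by (intro prob_space.finite_measure)
  show "square_integrable \<mu> (\<lambda>x. x)"
    using assms unfolding square_integrable_def borel_measurable_cong_borel[OF *(2)]
    by (simp add: P2_def)
qed

lemma couplings_D:
  assumes "\<gamma> \<in> couplings \<mu> \<nu>"
  shows "prob_space \<gamma>" "sets \<gamma> = sets borel" "distr \<gamma> borel fst = \<mu>" "distr \<gamma> borel snd = \<nu>"
    "finite_measure \<gamma>" "fst \<in> borel_measurable \<gamma>" "snd \<in> borel_measurable \<gamma>"
proof -
  show *: "prob_space \<gamma>" "sets \<gamma> = sets borel" "distr \<gamma> borel fst = \<mu>" "distr \<gamma> borel snd = \<nu>"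
    using assms by (auto simp: couplings_def)
  show "finite_measure \<gamma>" using *(1) by (rule prob_space.finite_measure)
  have eq: "measurable \<gamma> M = measurable (borel \<Otimes>\<^sub>M borel) M" for M :: "'c measure"
    using *(2) by (intro measurable_cong_sets refl) (simp only: borel_prod)
  show "fst \<in> borel_measurable \<gamma>" unfolding eq by simp
  show "snd \<in> borel_measurable \<gamma>" unfolding eq by simp
qed

lemma square_integrable_coupling:
  assumes "\<gamma> \<in> couplings \<mu> \<nu>"
  shows "square_integrable \<mu> f \<Longrightarrow> square_integrable \<gamma> (\<lambda>z. f (fst z))"
    and "square_integrable \<nu> f \<Longrightarrow> square_integrable \<gamma> (\<lambda>z. f (snd z))"
proof -
  note c = couplings_D[OF assms]
  show "square_integrable \<gamma> (\<lambda>z. f (fst z))" if "square_integrable \<mu> f"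
  proof -
    have "f \<in> borel_measurable borel"
      using square_integrable_measurable[OF that] unfolding c(3)[symmetric] by simp
    from square_integrable_distr[OF c(6) this] that show ?thesis unfolding c(3) by blast
  qed
  show "square_integrable \<gamma> (\<lambda>z. f (snd z))" if "square_integrable \<nu> f"
  proof -
    have "f \<in> borel_measurable borel"
      using square_integrable_measurable[OF that] unfolding c(4)[symmetric] by simp
    from square_integrable_distr[OF c(7) this] that show ?thesis unfolding c(4) by blast
  qed
qed

lemma square_integrable_displacement:
  assumes "\<mu> \<in> P2" "\<nu> \<in> P2" "\<gamma> \<in> couplings \<mu> \<nu>"
  shows "square_integrable \<gamma> (\<lambda>z. fst z - snd z)"
  using square_integrable_coupling[OF assms(3)] P2_D(3)[OF assms(1)] P2_D(3)[OF assms(2)]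
  by (intro square_integrable_diff)

section \<open>The Wasserstein distance as an infimum of transport costs\<close>

lemma transport_cost_nonneg: "0 \<le> transport_cost \<gamma>"
  by (simp add: transport_cost_def)

lemma bdd_below_transport_cost: "bdd_below (transport_cost ` A)"
  by (rule bdd_belowI2[of _ 0]) (simp add: transport_cost_nonneg)

text \<open>The product measure is a coupling. This is what gives the real infimum in
  \<open>W2\<close> its meaning, since the infimum of an empty set of reals carries no
  information.\<close>

lemma couplings_nonempty:
  assumes "\<mu> \<in> P2" "\<nu> \<in> P2"
  shows "couplings \<mu> \<nu> \<noteq> {}"
proof -
  note m = P2_D[OF assms(1)] and n = P2_D[OF assms(2)]
  interpret m: prob_space \<mu> by (fact m)
  interpret n: prob_space \<nu> by (fact n)
  interpret pair_prob_space \<mu> \<nu> ..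
  have s: "sets (\<mu> \<Otimes>\<^sub>M \<nu>) = sets (borel \<Otimes>\<^sub>M borel)"
    by (rule sets_pair_measure_cong[OF m(2) n(2)])
  have "distr (\<mu> \<Otimes>\<^sub>M \<nu>) borel fst = distr (\<mu> \<Otimes>\<^sub>M \<nu>) \<mu> fst"
    by (rule distr_cong) (auto simp: m(2))
  then have f1: "distr (\<mu> \<Otimes>\<^sub>M \<nu>) borel fst = \<mu>"
    using n.distr_pair_fst[of \<mu>] by (rule trans)
  have f2: "distr (\<mu> \<Otimes>\<^sub>M \<nu>) borel snd = \<nu>"
  proof -
    have "distr (\<mu> \<Otimes>\<^sub>M \<nu>) borel snd = distr (distr (\<nu> \<Otimes>\<^sub>M \<mu>) (\<mu> \<Otimes>\<^sub>M \<nu>) (\<lambda>(x, y). (y, x))) \<nu> snd"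
      by (subst distr_pair_swap, rule distr_cong) (auto simp: n(2))
    also have "\<dots> = distr (\<nu> \<Otimes>\<^sub>M \<mu>) \<nu> fst"
      by (subst distr_distr) (auto intro!: distr_cong)
    also have "\<dots> = \<nu>" by (rule m.distr_pair_fst)
    finally show ?thesis .
  qed
  have "\<mu> \<Otimes>\<^sub>M \<nu> \<in> couplings \<mu> \<nu>"
    unfolding couplings_def using f1 f2 prob_space_axioms s[unfolded borel_prod] by blast
  then show ?thesis by blast
qed

lemma W2_power2:
  assumes "\<mu> \<in> P2" "\<nu> \<in> P2"
  shows "(W2 \<mu> \<nu>)\<^sup>2 = (INF \<gamma> \<in> couplings \<mu> \<nu>. transport_cost \<gamma>)"
  unfolding W2_def using couplings_nonempty[OF assms]
  by (auto intro!: cINF_greatest simp: transport_cost_nonneg)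

lemma W2_power2_le:
  assumes "\<mu> \<in> P2" "\<nu> \<in> P2" "\<gamma> \<in> couplings \<mu> \<nu>"
  shows "(W2 \<mu> \<nu>)\<^sup>2 \<le> transport_cost \<gamma>"
  unfolding W2_power2[OF assms(1,2)] by (rule cINF_lower[OF bdd_below_transport_cost assms(3)])

lemma near_optimal_coupling:
  assumes "\<mu> \<in> P2" "\<nu> \<in> P2" "\<epsilon> > 0"
  obtains \<gamma> where "\<gamma> \<in> couplings \<mu> \<nu>" "transport_cost \<gamma> < (W2 \<mu> \<nu>)\<^sup>2 + \<epsilon>"
proof -
  have "(INF \<gamma> \<in> couplings \<mu> \<nu>. transport_cost \<gamma>) < (W2 \<mu> \<nu>)\<^sup>2 + \<epsilon>"
    using W2_power2[OF assms(1,2)] assms(3) by simp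
  then show ?thesis
    using that couplings_nonempty[OF assms(1,2)] cINF_less_iff[OF _ bdd_below_transport_cost] by blast
qed

lemma optimal_plans_cost:
  assumes "\<mu> \<in> P2" "\<nu> \<in> P2" "\<gamma> \<in> optimal_plans \<mu> \<nu>"
  shows "\<gamma> \<in> couplings \<mu> \<nu>" "transport_cost \<gamma> = (W2 \<mu> \<nu>)\<^sup>2"
proof -
  show c: "\<gamma> \<in> couplings \<mu> \<nu>" using assms(3) by (simp add: optimal_plans_def is_arg_min_def)
  have "transport_cost \<gamma> \<le> (INF \<gamma> \<in> couplings \<mu> \<nu>. transport_cost \<gamma>)"
    using assms(3) c by (intro cINF_greatest) (auto simp: optimal_plans_def is_arg_min_def not_less)
  then show "transport_cost \<gamma> = (W2 \<mu> \<nu>)\<^sup>2"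
    using W2_power2[OF assms(1,2)] W2_power2_le[OF assms(1,2) c] by linarith
qed

section \<open>Nested convex sets of square integrable maps\<close>

lemma norm_diff_sq: "(norm (a - b))\<^sup>2 = (norm a)\<^sup>2 - 2 * (a \<bullet> b) + (norm (b::'a::real_inner))\<^sup>2"
  by (simp add: power2_norm_eq_inner inner_diff_left inner_diff_right inner_commute)

lemma midpoint_norm_sq:
  "(norm ((1/2) *\<^sub>R (a + b)))\<^sup>2
    = (1/2) * (norm a)\<^sup>2 + (1/2) * (norm b)\<^sup>2 - (1/4) * (norm (a - (b::'a::real_inner)))\<^sup>2"
  by (simp add: power_mult_distrib power2_norm_eq_inner inner_diff_left inner_diff_right
      inner_add_left inner_add_right inner_commute power_divide field_simps)

text \<open>The increments have summable \<open>L^1\<close> norms, so their sum is finite almost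
  everywhere; the increments are then absolutely summable and telescope to a convergent
  sequence.\<close>

lemma L2_fast_Cauchy_limit:
  fixes u :: "nat \<Rightarrow> 'b \<Rightarrow> 'a::euclidean_space"
  assumes u: "\<And>j. square_integrable M (u j)" and M: "prob_space M"
    and fast: "\<And>j. (\<integral>x. (norm (u (Suc j) x - u j x))\<^sup>2 \<partial>M) \<le> (1/4)^j"
  shows "AE x in M. convergent (\<lambda>j. u j x)"
proof -
  interpret prob_space M by fact
  note u [measurable]
  have si: "square_integrable M (\<lambda>x. u (Suc j) x - u j x)" for j
    using u by (intro square_integrable_diff)
  let ?d = "\<lambda>j x. norm (u (Suc j) x - u j x)"
  \<comment> \<open>The weight \<open>2^j\<close> is chosen so that, under the bound
    \<open>(1/4)^j\<close>, both terms contribute \<open>(1/2)^j\<close> to the integral.\<close>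
  have amgm: "?d j x \<le> 2^j * (?d j x)\<^sup>2 + (1/2)^j" for j x
  proof -
    have "0 \<le> 2^j * (?d j x - (1/2)^j)\<^sup>2" by simp
    also have "\<dots> = 2^j * (?d j x)\<^sup>2 - 2 * ?d j x * (2^j * (1/2)^j) + (2^j * (1/2)^j) * (1/2)^j"
      by (simp only: power2_eq_square right_diff_distrib left_diff_distrib mult.assoc mult.commute mult.left_commute)
    also have "2^j * (1/2)^j = (1::real)" by (simp flip: power_mult_distrib)
    finally show ?thesis using norm_ge_zero[of "u (Suc j) x - u j x"] by linarith
  qed
  have int: "integrable M (?d j)" for j
    using square_integrable_integrable[OF si] finite_measure_axioms by (intro integrable_norm)
  have L1: "(\<integral>x. ?d j x \<partial>M) \<le> 2 * (1/2)^j" for j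
  proof -
    have "(\<integral>x. ?d j x \<partial>M) \<le> (\<integral>x. 2^j * (?d j x)\<^sup>2 + (1/2)^j \<partial>M)"
      by (intro integral_mono int amgm Bochner_Integration.integrable_add integrable_mult_right
          square_integrableD[OF si] integrable_const)
    also have "\<dots> = 2^j * (\<integral>x. (?d j x)\<^sup>2 \<partial>M) + (1/2)^j"
      using square_integrableD[OF si] by (subst Bochner_Integration.integral_add) (auto simp: prob_space)
    also have "\<dots> \<le> 2^j * (1/4)^j + (1/2)^j"
      using fast by (intro add_mono mult_left_mono) auto
    also have "2^j * (1/4)^j = (1/2::real)^j" by (simp flip: power_mult_distrib)
    finally show ?thesis by simp
  qed
  have "(\<integral>\<^sup>+x. (\<Sum>j. ennreal (?d j x)) \<partial>M) = (\<Sum>j. \<integral>\<^sup>+x. ennreal (?d j x) \<partial>M)"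
    by (rule nn_integral_suminf) measurable
  also have "\<dots> = (\<Sum>j. ennreal (\<integral>x. ?d j x \<partial>M))"
    using int by (simp add: nn_integral_eq_integral)
  also have "\<dots> \<le> (\<Sum>j. ennreal (2 * (1/2)^j))"
    by (intro suminf_le ennreal_leI L1) auto
  also have "\<dots> = ennreal (\<Sum>j. 2 * (1/2)^j)"
    by (intro suminf_ennreal2) (auto intro!: summable_mult summable_geometric)
  finally have "(\<integral>\<^sup>+x. (\<Sum>j. ennreal (?d j x)) \<partial>M) \<noteq> \<infinity>"
    by (metis ennreal_neq_top infinity_ennreal_def neq_top_trans)
  then have "AE x in M. (\<Sum>j. ennreal (?d j x)) \<noteq> \<infinity>"
    by (intro nn_integral_noteq_infinite) auto
  then show ?thesis
  proof eventually_elim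
    case (elim x)
    then have "summable (\<lambda>j. ?d j x)"
      by (intro summable_suminf_not_top) auto
    then have "summable (\<lambda>j. u (Suc j) x - u j x)"
      by (rule summable_norm_cancel)
    then have "convergent (\<lambda>n. \<Sum>j<n. u (Suc j) x - u j x)"
      by (simp add: summable_iff_convergent)
    then have "convergent (\<lambda>n. u n x - u 0 x)"
      unfolding sum_lessThan_telescope[of "\<lambda>j. u j x"] .
    then have "convergent (\<lambda>n. (u n x - u 0 x) + u 0 x)"
      by (intro convergent_add convergent_const)
    then show ?case by simp
  qed
qed

text \<open>The Riesz-Fischer argument: a rapidly converging subsequence has an almost everywhere
  limit, and Fatou's lemma turns the Cauchy bounds into bounds on the distance to that
  limit.\<close>

lemma L2_complete:
  fixes f :: "nat \<Rightarrow> 'b \<Rightarrow> 'a::euclidean_space"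
  assumes f: "\<And>j. square_integrable M (f j)" and M: "prob_space M"
    and Cauchy: "\<And>\<epsilon>. \<epsilon> > 0 \<Longrightarrow> \<exists>N. \<forall>m\<ge>N. \<forall>n\<ge>N. (\<integral>x. (norm (f m x - f n x))\<^sup>2 \<partial>M) \<le> \<epsilon>"
  obtains g where "square_integrable M g" "(\<lambda>n. \<integral>x. (norm (f n x - g x))\<^sup>2 \<partial>M) \<longlonglongrightarrow> 0"
proof -
  interpret prob_space M by fact
  note f [measurable]
  have "\<forall>j. \<exists>N. \<forall>m\<ge>N. \<forall>n\<ge>N. (\<integral>x. (norm (f m x - f n x))\<^sup>2 \<partial>M) \<le> (1/4)^j"
    using Cauchy by simp
  then obtain N where N: "\<And>j m n. m \<ge> N j \<Longrightarrow> n \<ge> N j \<Longrightarrow> (\<integral>x. (norm (f m x - f n x))\<^sup>2 \<partial>M) \<le> (1/4)^j"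
    by metis
  \<comment> \<open>Summing the thresholds makes \<open>r j\<close> exceed \<open>N i\<close> for
    every \<open>i \<le> j\<close>, so consecutive terms of the subsequence both lie beyond
    \<open>N j\<close>; the summand \<open>j\<close> makes the indices unbounded.\<close>
  define r where "r j = (\<Sum>i\<le>j. N i) + j" for j
  have N_le: "i \<le> j \<Longrightarrow> N i \<le> (\<Sum>i\<le>j. N i)" for i j
    by (rule member_le_sum) auto
  have rN: "r j \<ge> N j" for j
    unfolding r_def by (intro trans_le_add1 N_le) simp
  have rSuc: "r (Suc j) \<ge> N j" for j
    unfolding r_def by (intro trans_le_add1 N_le) simp
  have rge: "r j \<ge> j" for j by (simp add: r_def)
  define u where "u j = f (r j)" for j
  have u: "square_integrable M (u j)" for j using f by (simp add: u_def)
  note u [measurable]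
  have conv: "AE x in M. convergent (\<lambda>j. u j x)"
    using rN rSuc by (intro L2_fast_Cauchy_limit u M) (auto simp: u_def intro!: N)
  define g where "g x = lim (\<lambda>j. u j x)" for x
  have g [measurable]: "g \<in> borel_measurable M"
    unfolding g_def by measurable
  have si: "square_integrable M (\<lambda>x. f n x - u j x)" for n j
    using f u by (intro square_integrable_diff)
  \<comment> \<open>The term \<open>f n\<close> stays fixed while \<open>u j\<close> runs to the
    limit \<open>g\<close>. Nonnegative integrals are used because square integrability of the
    difference is only a consequence.\<close>
  have Fatou: "(\<integral>\<^sup>+x. ennreal ((norm (f n x - g x))\<^sup>2) \<partial>M) \<le> ennreal \<epsilon>"
    if \<epsilon>: "\<forall>m\<ge>K. \<forall>n\<ge>K. (\<integral>x. (norm (f m x - f n x))\<^sup>2 \<partial>M) \<le> \<epsilon>" and "n \<ge> K" for n K \<epsilon>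
  proof -
    have "(\<integral>\<^sup>+x. ennreal ((norm (f n x - g x))\<^sup>2) \<partial>M)
      = (\<integral>\<^sup>+x. liminf (\<lambda>j. ennreal ((norm (f n x - u j x))\<^sup>2)) \<partial>M)"
    proof (rule nn_integral_cong_AE, use conv in eventually_elim)
      case (elim x)
      then have "(\<lambda>j. u j x) \<longlonglongrightarrow> g x" unfolding g_def by (simp add: convergent_LIMSEQ_iff)
      then have "(\<lambda>j. ennreal ((norm (f n x - u j x))\<^sup>2)) \<longlonglongrightarrow> ennreal ((norm (f n x - g x))\<^sup>2)"
        by (intro tendsto_intros tendsto_ennrealI)
      from lim_imp_Liminf[OF sequentially_bot this] show ?case by (rule sym)
    qed
    also have "\<dots> \<le> liminf (\<lambda>j. \<integral>\<^sup>+x. ennreal ((norm (f n x - u j x))\<^sup>2) \<partial>M)"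
      by (rule nn_integral_liminf) measurable
    also have "\<dots> \<le> ennreal \<epsilon>"
    proof (rule Liminf_le)
      show "\<forall>\<^sub>F j in sequentially. (\<integral>\<^sup>+x. ennreal ((norm (f n x - u j x))\<^sup>2) \<partial>M) \<le> ennreal \<epsilon>"
        using eventually_ge_at_top[of K]
      proof eventually_elim
        case (elim j)
        then have "(\<integral>x. (norm (f n x - u j x))\<^sup>2 \<partial>M) \<le> \<epsilon>"
          using \<epsilon> \<open>n \<ge> K\<close> rge[of j] unfolding u_def by (meson le_trans)
        then show ?case
          using square_integrableD[OF si] by (simp add: nn_integral_eq_integral ennreal_leI)
      qed
    qed simp
    finally show ?thesis .
  qed
  have sig: "square_integrable M (\<lambda>x. f n x - g x)" if
     "\<forall>m\<ge>K. \<forall>n\<ge>K. (\<integral>x. (norm (f m x - f n x))\<^sup>2 \<partial>M) \<le> \<epsilon>" "n \<ge> K" for n K \<epsilon>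
    unfolding square_integrable_def
    using Fatou[OF that] by (auto intro!: integrableI_bounded simp: le_less_trans[OF _ ennreal_less_top])
  obtain K where K: "\<forall>m\<ge>K. \<forall>n\<ge>K. (\<integral>x. (norm (f m x - f n x))\<^sup>2 \<partial>M) \<le> 1"
    using Cauchy[of 1] by auto
  have "square_integrable M (\<lambda>x. f K x - (f K x - g x))"
    by (rule square_integrable_diff[OF f sig[OF K order_refl]])
  then have G: "square_integrable M g" by simp
  moreover have "(\<lambda>n. \<integral>x. (norm (f n x - g x))\<^sup>2 \<partial>M) \<longlonglongrightarrow> 0"
  proof (rule LIMSEQ_I)
    fix e :: real assume "e > 0"
    then obtain K where K: "\<forall>m\<ge>K. \<forall>n\<ge>K. (\<integral>x. (norm (f m x - f n x))\<^sup>2 \<partial>M) \<le> e / 2"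
      using Cauchy[of "e/2"] by auto
    have "(\<integral>x. (norm (f n x - g x))\<^sup>2 \<partial>M) \<le> e / 2" if "n \<ge> K" for n
      using Fatou[OF K that] square_integrableD[OF sig[OF K that]] \<open>e > 0\<close>
      by (simp add: nn_integral_eq_integral)
    then show "\<exists>K. \<forall>n\<ge>K. norm ((\<integral>x. (norm (f n x - g x))\<^sup>2 \<partial>M) - 0) < e"
      using \<open>e > 0\<close> by (intro exI[of _ K]) (fastforce)
  qed
  ultimately show ?thesis by (rule that)
qed

text \<open>Elements of almost minimal norm form a Cauchy sequence by the parallelogram law. This
  replaces weak compactness of balls in \<open>L\<^sup>2\<close>.\<close>

lemma L2_nested_convex_inter:
  fixes K :: "nat \<Rightarrow> ('b \<Rightarrow> 'a::euclidean_space) set"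
  assumes M: "prob_space M"
    and si: "\<And>k f. f \<in> K k \<Longrightarrow> square_integrable M f"
    and decr: "\<And>k j. k \<le> j \<Longrightarrow> K j \<subseteq> K k"
    and mid: "\<And>k f g. f \<in> K k \<Longrightarrow> g \<in> K k \<Longrightarrow> (\<lambda>x. (1/2) *\<^sub>R (f x + g x)) \<in> K k"
    and closed: "\<And>k f g. (\<And>j. f j \<in> K k) \<Longrightarrow> square_integrable M g \<Longrightarrow>
       (\<lambda>j. \<integral>x. (norm (f j x - g x))\<^sup>2 \<partial>M) \<longlonglongrightarrow> 0 \<Longrightarrow> g \<in> K k"
    and bounded: "\<And>k. \<exists>f\<in>K k. (\<integral>x. (norm (f x))\<^sup>2 \<partial>M) \<le> R"
  obtains g where "\<And>k. g \<in> K k" "(\<integral>x. (norm (g x))\<^sup>2 \<partial>M) \<le> R"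
proof -
  interpret prob_space M by fact
  let ?I = "\<lambda>f. \<integral>x. (norm (f x))\<^sup>2 \<partial>M"
  \<comment> \<open>The infimum of the squared norm grows as the sets shrink and stays below
    \<open>R\<close>, hence converges to some \<open>E\<close>; the Cauchy estimate is measured by
    \<open>E - e k\<close>.\<close>
  define e where "e k = (INF f\<in>K k. ?I f)" for k
  have bdd: "bdd_below (?I ` K k)" for k by (rule bdd_belowI2[of _ 0]) simp
  have ne: "K k \<noteq> {}" for k using bounded by blast
  have e_le: "f \<in> K k \<Longrightarrow> e k \<le> ?I f" for f k unfolding e_def by (rule cINF_lower[OF bdd])
  have eR: "e k \<le> R" for k using bounded[of k] e_le order_trans by blast
  have e_mono: "incseq e"
    unfolding incseq_def e_def using decr ne by (auto intro!: cINF_superset_mono bdd)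
  obtain E where E: "e \<longlonglongrightarrow> E" "\<And>i. e i \<le> E"
    using incseq_convergent[OF e_mono] eR by blast
  have ER: "E \<le> R" using E(1) eR by (intro LIMSEQ_le_const2) auto
  have "\<exists>f\<in>K k. ?I f < e k + 1 / Suc k" for k
    unfolding e_def using cINF_less_iff[OF ne bdd, of k "(INF f\<in>K k. ?I f) + 1 / Suc k"] by simp
  then obtain f where fK: "\<And>k. f k \<in> K k" and fe: "\<And>k. ?I (f k) < e k + 1 / Suc k" by metis
  have f: "square_integrable M (f k)" for k using fK si by blast
  note f [measurable]
  \<comment> \<open>The midpoint of two elements of \<open>K k\<close> lies in \<open>K k\<close>,
    so its squared norm is at least \<open>e k\<close>; near-minimality of both elements then forces
    them close together.\<close>
  have parallelogram: "(\<integral>x. (norm (f m x - f n x))\<^sup>2 \<partial>M) \<le> 4 * (E - e k) + 4 / Suc k"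
    if "m \<ge> k" "n \<ge> k" for m n k
  proof -
    have fmn: "f m \<in> K k" "f n \<in> K k" using fK decr that by blast+
    have "e k \<le> ?I (\<lambda>x. (1/2) *\<^sub>R (f m x + f n x))"
      by (rule e_le[OF mid[OF fmn]])
    also have "\<dots> = (\<integral>x. (1/2) * (norm (f m x))\<^sup>2 + (1/2) * (norm (f n x))\<^sup>2 - (1/4) * (norm (f m x - f n x))\<^sup>2 \<partial>M)"
      by (rule Bochner_Integration.integral_cong)
        (simp_all only: midpoint_norm_sq)
    also have "\<dots> = (1/2) * ?I (f m) + (1/2) * ?I (f n) - (1/4) * (\<integral>x. (norm (f m x - f n x))\<^sup>2 \<partial>M)"
      using square_integrableD[OF f] square_integrableD[OF square_integrable_diff[OF f f]] by simp
    finally have "(\<integral>x. (norm (f m x - f n x))\<^sup>2 \<partial>M) \<le> 2 * ?I (f m) + 2 * ?I (f n) - 4 * e k" by simp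
    note calculation = this
    have "?I (f i) \<le> E + 1 / Suc k" if "i \<ge> k" for i
    proof -
      have "1 / real (Suc i) \<le> 1 / real (Suc k)" using that by (intro divide_left_mono) auto
      then show ?thesis using fe[of i] E(2)[of i] by linarith
    qed
    from this[OF that(1)] this[OF that(2)] calculation
    show ?thesis by simp
  qed
  have one_over_Suc: "(\<lambda>k. 1 / real (Suc k)) \<longlonglongrightarrow> 0"
    using LIMSEQ_inverse_real_of_nat by (simp only: inverse_eq_divide)
  have lim0: "(\<lambda>k. 4 * (E - e k) + 4 / Suc k) \<longlonglongrightarrow> 0"
  proof -
    have "(\<lambda>k. 4 * (E - e k) + 4 * (1 / Suc k)) \<longlonglongrightarrow> 4 * (E - E) + 4 * 0"
      by (intro tendsto_intros E(1) one_over_Suc)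
    then show ?thesis by simp
  qed
  obtain g where g: "square_integrable M g" "(\<lambda>n. \<integral>x. (norm (f n x - g x))\<^sup>2 \<partial>M) \<longlonglongrightarrow> 0"
  proof (rule L2_complete[OF f M])
    fix \<epsilon> :: real assume "\<epsilon> > 0"
    then have "\<forall>\<^sub>F k in sequentially. 4 * (E - e k) + 4 / Suc k < \<epsilon>"
      using lim0 by (rule order_tendstoD(2)[rotated])
    then obtain k where "4 * (E - e k) + 4 / Suc k < \<epsilon>"
      by (meson eventually_sequentially order_refl)
    then show "\<exists>N. \<forall>m\<ge>N. \<forall>n\<ge>N. (\<integral>x. (norm (f m x - f n x))\<^sup>2 \<partial>M) \<le> \<epsilon>"
      using parallelogram[of k] by (meson less_imp_le order_trans)
  qed
  note g(1) [measurable]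
  have "g \<in> K k" for k
  proof (rule closed[of "\<lambda>j. f (j + k)"])
    show "f (j + k) \<in> K k" for j using fK decr[of k "j + k"] by auto
    show "(\<lambda>j. \<integral>x. (norm (f (j + k) x - g x))\<^sup>2 \<partial>M) \<longlonglongrightarrow> 0"
      by (rule LIMSEQ_ignore_initial_segment[OF g(2)])
  qed (fact g)
  moreover have "?I g \<le> R"
  proof -
    let ?D = "\<lambda>n. \<integral>x. (norm (f n x - g x))\<^sup>2 \<partial>M"
    have fR: "?I (f n) \<le> R + 1 / Suc n" for n using fe[of n] eR[of n] by linarith
    \<comment> \<open>A weighted form of the triangle inequality. The free parameter
      \<open>t\<close> is kept while \<open>n\<close> tends to infinity and is made small only
      afterwards.\<close>
    have young: "?I g \<le> (1 + t) * ?I (f n) + (1 + 1/t) * ?D n" if "t > 0" for t n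
    proof -
      have pt: "(norm (g x))\<^sup>2 \<le> (1 + t) * (norm (f n x))\<^sup>2 + (1 + 1/t) * (norm (f n x - g x))\<^sup>2" for x
      proof -
        have "0 \<le> (1/t) * (norm ((1 + t) *\<^sub>R f n x - g x))\<^sup>2" using that by simp
        also have "(norm ((1 + t) *\<^sub>R f n x - g x))\<^sup>2
            = (1 + t)\<^sup>2 * (norm (f n x))\<^sup>2 - 2 * (1 + t) * (f n x \<bullet> g x) + (norm (g x))\<^sup>2"
          by (simp add: norm_diff_sq power_mult_distrib)
        also have "(1/t) * \<dots> = (1 + t) * (norm (f n x))\<^sup>2 + (1 + 1/t) * (norm (f n x - g x))\<^sup>2 - (norm (g x))\<^sup>2"
          using that unfolding norm_diff_sq by (simp add: field_simps power2_eq_square)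
        finally show ?thesis by simp
      qed
      have "?I g \<le> (\<integral>x. (1 + t) * (norm (f n x))\<^sup>2 + (1 + 1/t) * (norm (f n x - g x))\<^sup>2 \<partial>M)"
        using g(1) f pt by (intro integral_mono square_integrableD Bochner_Integration.integrable_add
            integrable_mult_right square_integrable_diff)
      also have "\<dots> = (1 + t) * ?I (f n) + (1 + 1/t) * ?D n"
        using square_integrableD[OF f] square_integrableD[OF square_integrable_diff[OF f g(1)]] by simp
      finally show ?thesis .
    qed
    have lim: "?I g \<le> (1 + t) * R" if "t > 0" for t
    proof (rule LIMSEQ_le_const)
      have "(\<lambda>n. (1 + t) * (R + 1 / Suc n) + (1 + 1/t) * ?D n)
          \<longlonglongrightarrow> (1 + t) * (R + 0) + (1 + 1/t) * 0"
        by (intro tendsto_add tendsto_mult tendsto_const g(2) one_over_Suc)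
      then show "(\<lambda>n. (1 + t) * (R + 1 / Suc n) + (1 + 1/t) * ?D n) \<longlonglongrightarrow> (1 + t) * R"
        by (simp only: mult_zero_right add_0_right)
      show "\<exists>N. \<forall>n\<ge>N. ?I g \<le> (1 + t) * (R + 1 / Suc n) + (1 + 1/t) * ?D n"
      proof (intro exI allI impI)
        fix n
        have "(1 + t) * ?I (f n) \<le> (1 + t) * (R + 1 / Suc n)"
          using fR that by (intro mult_left_mono) auto
        then show "?I g \<le> (1 + t) * (R + 1 / Suc n) + (1 + 1/t) * ?D n"
          using young[OF that, of n] by linarith
      qed
    qed
    have R0: "0 \<le> R" using bounded[of 0] by (meson Bochner_Integration.integral_nonneg zero_le_power2 order_trans)
    show ?thesis
    proof (rule field_le_epsilon)
      fix d :: real assume "d > 0"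
      \<comment> \<open>With \<open>t = d / (R + 1)\<close> the excess \<open>t * R\<close> is at
        most \<open>d\<close>; adding 1 in the denominator covers \<open>R = 0\<close>.\<close>
      have "(1 + d / (R + 1)) * R \<le> R + d"
        using R0 \<open>d > 0\<close> by (simp add: field_simps)
      then show "?I g \<le> R + d" using lim[of "d / (R + 1)"] R0 \<open>d > 0\<close> by simp
    qed
  qed
  ultimately show ?thesis by (rule that)
qed

section \<open>Convex functions with Lipschitz gradient\<close>

lemma GDERIV_unique:
  assumes "GDERIV f x :> D" "GDERIV f x :> D'"
  shows "D = D'"
proof -
  have "(\<lambda>h. h \<bullet> D) = (\<lambda>h. h \<bullet> D')"
    using assms unfolding gderiv_def by (rule has_derivative_unique)
  then have "(D - D') \<bullet> D = (D - D') \<bullet> D'" by (rule fun_cong)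
  then have "(D - D') \<bullet> (D - D') = 0" by (simp add: inner_diff_right)
  then show ?thesis by simp
qed

text \<open>Riesz representation in finite dimension: the vector whose coordinates are the
  derivatives along the basis represents the derivative, so the definite description in
  \<open>gradient\<close> has a unique solution.\<close>

lemma GDERIV_gradient:
  fixes f :: "'a::euclidean_space \<Rightarrow> real"
  assumes "f differentiable (at x)"
  shows "GDERIV f x :> gradient f x"
proof -
  obtain f' where f': "(f has_derivative f') (at x)"
    using assms by (auto simp: differentiable_def)
  interpret bounded_linear f' using f' by (rule has_derivative_bounded_linear)
  let ?D = "\<Sum>b\<in>Basis. f' b *\<^sub>R b"
  have "f' = (\<lambda>h. h \<bullet> ?D)"
  proof
    fix h
    have "f' h = f' (\<Sum>b\<in>Basis. (h \<bullet> b) *\<^sub>R b)" by (simp add: euclidean_representation)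
    also have "\<dots> = h \<bullet> ?D" by (simp add: sum scaleR inner_sum_right mult.commute)
    finally show "f' h = h \<bullet> ?D" .
  qed
  then have "GDERIV f x :> ?D" using f' unfolding gderiv_def by simp
  then show ?thesis unfolding gradient_def by (rule theI) (rule GDERIV_unique[OF _ \<open>GDERIV f x :> ?D\<close>])
qed

lemma gradient_along_line:
  assumes "\<And>x. GDERIV H x :> g x"
  shows "((\<lambda>t. H (x + t *\<^sub>R v)) has_real_derivative (v \<bullet> g (x + t *\<^sub>R v))) (at t within S)"
proof -
  have "((\<lambda>t. H (x + t *\<^sub>R v)) has_derivative (\<lambda>s. (s *\<^sub>R v) \<bullet> g (x + t *\<^sub>R v))) (at t)"
    by (rule has_derivative_compose[of "\<lambda>t. x + t *\<^sub>R v" "\<lambda>s. s *\<^sub>R v" t UNIV H])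
      (auto intro!: derivative_eq_intros assms[unfolded gderiv_def])
  then show ?thesis
    unfolding has_field_derivative_def by (auto intro: has_derivative_at_withinI simp: mult_commute_abs)
qed

text \<open>Along the segment from \<open>x\<close> to \<open>y\<close> convexity bounds every
  difference quotient by \<open>H y - H x\<close>; the one-sided limit at the start of the segment
  is the directional derivative.\<close>

lemma convex_gradient_lower_bound:
  fixes H :: "'a::euclidean_space \<Rightarrow> real"
  assumes "convex_on UNIV H" and g: "\<And>x. GDERIV H x :> g x"
  shows "H x + g x \<bullet> (y - x) \<le> H y"
proof -
  let ?h = "\<lambda>t::real. H (x + t *\<^sub>R (y - x))"
  have conv: "convex_on {0..1} ?h"
  proof (rule convex_onI)
    fix t a b :: real assume t: "0 < t" "t < 1"
    have "x + ((1 - t) *\<^sub>R a + t *\<^sub>R b) *\<^sub>R (y - x)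
        = (1 - t) *\<^sub>R (x + a *\<^sub>R (y - x)) + t *\<^sub>R (x + b *\<^sub>R (y - x))"
      by (simp add: algebra_simps)
    then show "?h ((1 - t) *\<^sub>R a + t *\<^sub>R b) \<le> (1 - t) * ?h a + t * ?h b"
      using convex_onD[OF assms(1), of t "x + a *\<^sub>R (y - x)" "x + b *\<^sub>R (y - x)"] t by simp
  qed simp
  have "((\<lambda>t. (?h t - ?h 0) / (t - 0)) \<longlongrightarrow> (y - x) \<bullet> g x) (at 0 within {0<..})"
    using gradient_along_line[OF g, of x "y - x" 0 "{0<..}"] unfolding has_field_derivative_iff by simp
  then have "(y - x) \<bullet> g x \<le> H y - H x"
  proof (rule tendsto_upperbound)
    show "\<forall>\<^sub>F t in at 0 within {0<..}. (?h t - ?h 0) / (t - 0) \<le> H y - H x"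
    proof (rule eventually_at_rightI[of 0 1])
      fix t :: real assume t: "t \<in> {0<..<1}"
      have "?h t \<le> (1 - t) * H x + t * H y"
        using convex_onD[OF conv, of t 0 1] t by simp
      then show "(?h t - ?h 0) / (t - 0) \<le> H y - H x"
        using t by (simp add: field_simps)
    qed simp
  qed simp
  then show ?thesis by (simp add: inner_commute)
qed

text \<open>The mean value theorem gives the gradient at an intermediate point, which deviates from
  \<open>g x\<close> by at most \<open>L\<close> times the length. The constant is \<open>L\<close>
  instead of the sharp \<open>L/2\<close>; it only enters the quadratic remainder.\<close>

lemma lipschitz_gradient_upper_bound:
  fixes H :: "'a::euclidean_space \<Rightarrow> real"
  assumes g: "\<And>x. GDERIV H x :> g x" and L: "\<And>x y. norm (g x - g y) \<le> L * norm (x - y)" and "0 \<le> L"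
  shows "H y \<le> H x + g x \<bullet> (y - x) + L * (norm (y - x))\<^sup>2"
proof -
  let ?h = "\<lambda>t::real. H (x + t *\<^sub>R (y - x))"
  obtain t where t: "0 < t" "t < 1" and eq: "?h 1 - ?h 0 = (1 - 0) * ((y - x) \<bullet> g (x + t *\<^sub>R (y - x)))"
    using MVT2[of 0 1 ?h "\<lambda>t. (y - x) \<bullet> g (x + t *\<^sub>R (y - x))"] gradient_along_line[OF g] by auto
  have "(y - x) \<bullet> (g (x + t *\<^sub>R (y - x)) - g x) \<le> norm (y - x) * norm (g (x + t *\<^sub>R (y - x)) - g x)"
    by (rule norm_cauchy_schwarz)
  also have "\<dots> \<le> norm (y - x) * (L * (t * norm (y - x)))"
    using L[of "x + t *\<^sub>R (y - x)" x] t by (intro mult_left_mono) auto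
  also have "\<dots> = t * (L * (norm (y - x))\<^sup>2)" by (simp add: power2_eq_square)
  also have "\<dots> \<le> 1 * (L * (norm (y - x))\<^sup>2)"
    using t \<open>0 \<le> L\<close> by (intro mult_right_mono) auto
  finally have "(y - x) \<bullet> g (x + t *\<^sub>R (y - x)) \<le> (y - x) \<bullet> g x + L * (norm (y - x))\<^sup>2"
    by (simp add: inner_diff_right)
  then show ?thesis using eq by (simp add: inner_commute)
qed

text \<open>The mean value inequality with the operator norm of the Hessian. Differentiability of
  the gradient ensures that \<open>Blinfun\<close> in \<open>hessian\<close> really wraps a bounded
  linear map.\<close>

lemma gradient_lipschitz:
  assumes "C2 H" "bounded (range (hessian H))"
  obtains L where "0 \<le> L" "\<And>x y. norm (gradient H x - gradient H y) \<le> L * norm (x - y)"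
proof -
  obtain L where L: "\<And>x. norm (hessian H x) \<le> L"
    using assms(2) by (auto simp: bounded_iff)
  have d: "(gradient H has_derivative blinfun_apply (hessian H x)) (at x)" for x
  proof -
    have *: "(gradient H has_derivative frechet_derivative (gradient H) (at x)) (at x)"
      using assms(1) by (auto simp: C2_def frechet_derivative_works[symmetric])
    then show ?thesis
      unfolding hessian_def by (simp add: bounded_linear_Blinfun_apply[OF has_derivative_bounded_linear[OF *]])
  qed
  have "norm (gradient H x - gradient H y) \<le> L * norm (x - y)" for x y
    by (rule differentiable_bound[of UNIV "gradient H" "\<lambda>x. blinfun_apply (hessian H x)"])
      (use d L in \<open>auto simp: norm_blinfun.rep_eq[symmetric]\<close>)
  moreover have "0 \<le> L" using L[of 0] norm_ge_zero order_trans by blast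
  ultimately show ?thesis using that by blast
qed

text \<open>Expansion makes \<open>S\<close> injective with a 1-Lipschitz inverse on its range. The
  range is closed, because preimages of a convergent sequence are Cauchy, so the inverse extended by
  0 is Borel.\<close>

lemma measurable_left_inverse:
  fixes S :: "'a::euclidean_space \<Rightarrow> 'a"
  assumes cont: "continuous_on UNIV S" and expand: "\<And>x y. norm (x - y) \<le> norm (S x - S y)"
  obtains R where "R \<in> borel_measurable borel" "\<And>x. R (S x) = x"
proof -
  have inj: "inj S"
  proof (rule injI)
    fix x y assume "S x = S y"
    then show "x = y" using expand[of x y] by simp
  qed
  have cl: "closed (range S)"
    unfolding closed_sequential_limits
  proof (intro allI impI, elim conjE)
    fix u l assume "\<forall>n. u n \<in> range S" and ul: "u \<longlonglongrightarrow> l"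
    then have "\<forall>n. \<exists>a. u n = S a" by blast
    then obtain x where "\<forall>n. u n = S (x n)" by (rule exE[OF choice])
    then have x: "u = (\<lambda>n. S (x n))" by (simp add: fun_eq_iff)
    have "Cauchy x"
    proof (rule metric_CauchyI)
      fix e :: real assume "0 < e"
      then obtain M where "\<forall>m\<ge>M. \<forall>n\<ge>M. dist (u m) (u n) < e"
        using LIMSEQ_imp_Cauchy[OF ul] by (meson metric_CauchyD)
      then show "\<exists>M. \<forall>m\<ge>M. \<forall>n\<ge>M. dist (x m) (x n) < e"
        unfolding x dist_norm by (meson expand le_less_trans)
    qed
    then obtain a where a: "x \<longlonglongrightarrow> a" using Cauchy_convergent_iff convergent_def by blast
    then have "(\<lambda>n. S (x n)) \<longlonglongrightarrow> S a"
      using cont by (auto intro: continuous_on_tendsto_compose)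
    then have "l = S a" using ul unfolding x by (rule LIMSEQ_unique[rotated])
    then show "l \<in> range S" by simp
  qed
  have "continuous_on (range S) (inv S)"
    unfolding continuous_on_iff
  proof (intro ballI allI impI)
    fix z and e :: real assume z: "z \<in> range S" and e: "0 < e"
    have "dist (inv S z') (inv S z) < e" if "z' \<in> range S" "dist z' z < e" for z'
      using expand[of "inv S z'" "inv S z"] that(2)
      unfolding f_inv_into_f[OF z] f_inv_into_f[OF that(1)] dist_norm by (rule le_less_trans)
    then show "\<exists>d>0. \<forall>z'\<in>range S. dist z' z < d \<longrightarrow> dist (inv S z') (inv S z) < e"
      using e by blast
  qed
  then have "(\<lambda>z. if z \<in> range S then inv S z else 0) \<in> borel_measurable borel"
    using cl by (intro borel_measurable_continuous_on_if) auto
  then show ?thesis by (rule that) (simp add: inv_f_f[OF inj])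
qed

section \<open>Integrability of potentials and pushforwards\<close>

lemma potential_integrable:
  assumes "quadratic_growth f" "continuous_on UNIV f" "\<mu> \<in> P2"
  shows "integrable \<mu> f"
proof -
  note m = P2_D[OF assms(3)]
  interpret prob_space \<mu> by (fact m)
  obtain a where a: "a > 0" "\<And>x. \<bar>f x\<bar> \<le> a * ((norm x)\<^sup>2 + 1)"
    using assms(1) by (auto simp: quadratic_growth_def)
  show ?thesis
  proof (rule Bochner_Integration.integrable_bound)
    show "integrable \<mu> (\<lambda>x. a * ((norm x)\<^sup>2 + 1))"
      by (intro integrable_mult_right Bochner_Integration.integrable_add square_integrableD[OF m(3)] integrable_const)
    show "f \<in> borel_measurable \<mu>"
      unfolding borel_measurable_cong_borel[OF m(2)] by (rule borel_measurable_continuous_onI[OF assms(2)])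
    show "AE x in \<mu>. norm (f x) \<le> norm (a * ((norm x)\<^sup>2 + 1))"
      using a by (intro AE_I2) (auto intro: order_trans[OF a(2)])
  qed
qed

lemma distr_P2:
  assumes "\<mu> \<in> P2" "T \<in> borel_measurable borel" "square_integrable \<mu> T"
  shows "distr \<mu> borel T \<in> P2"
proof -
  note m = P2_D[OF assms(1)]
  have T: "T \<in> borel_measurable \<mu>" using assms(2) unfolding borel_measurable_cong_borel[OF m(2)] .
  have "square_integrable (distr \<mu> borel T) (\<lambda>x. x)"
    using assms(3) by (subst square_integrable_distr[OF T]) auto
  then show ?thesis
    unfolding P2_def using prob_space.prob_space_distr[OF m(1) T] by (auto dest: square_integrableD)
qed

section \<open>Approximate gluing of plans\<close>

text \<open>Two plans with a common first marginal \<open>\<mu>\<close> are glued without disintegration: the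
  space is cut into the countably many cells \<open>q -` {n}\<close>, and inside each cell the two plans are
  made independent. The first coordinates then agree only up to the cell diameter. Cells of
  \<open>\<mu>\<close>-mass zero get weight zero through \<open>1 / 0 = 0\<close>.\<close>

locale cell_gluing =
  fixes \<gamma> \<gamma>' :: "('a::euclidean_space \<times> 'a) measure" and \<mu> :: "'a measure" and q :: "'a \<Rightarrow> nat"
  assumes prob: "prob_space \<gamma>" "prob_space \<gamma>'"
    and sets_\<gamma> [measurable_cong]: "sets \<gamma> = sets (borel \<Otimes>\<^sub>M borel)" "sets \<gamma>' = sets (borel \<Otimes>\<^sub>M borel)"
    and marginal: "distr \<gamma> borel fst = \<mu>" "distr \<gamma>' borel fst = \<mu>"
    and q [measurable]: "q \<in> borel \<rightarrow>\<^sub>M count_space UNIV"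
begin

definition cell_mass :: "'a \<Rightarrow> real" where
  "cell_mass x = measure \<mu> (q -` {q x})"

definition weight :: "'a \<Rightarrow> 'a \<Rightarrow> real" where
  "weight x x' = (if q x = q x' then 1 / cell_mass x else 0)"

text \<open>This is the sum over all cells of positive mass of the product of the two plans, each
  restricted to first coordinates in that cell, divided by the mass of the cell.\<close>

definition glued :: "(('a \<times> 'a) \<times> 'a \<times> 'a) measure" where
  "glued = density (\<gamma> \<Otimes>\<^sub>M \<gamma>') (\<lambda>P. ennreal (weight (fst (fst P)) (fst (snd P))))"

text \<open>The conditional expectation of \<open>v\<close> under \<open>\<gamma>'\<close> given the
  cell of the first coordinate, as a function constant on cells.\<close>

definition cell_mean :: "('a \<times> 'a \<Rightarrow> 'a) \<Rightarrow> 'a \<Rightarrow> 'a" where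
  "cell_mean v x = (\<integral>p. weight x (fst p) *\<^sub>R v p \<partial>\<gamma>')"

sublocale g: prob_space \<gamma> by (fact prob)
sublocale g': prob_space \<gamma>' by (fact prob)
sublocale P: pair_prob_space \<gamma> \<gamma>' ..

lemma prob_\<mu>: "prob_space \<mu>" and sets_\<mu> [measurable_cong]: "sets \<mu> = sets borel"
  using g.prob_space_distr[of fst borel] marginal by auto

sublocale m: prob_space \<mu> by (fact prob_\<mu>)

section \<open>Cell masses and weights\<close>

lemma cell_mass_measurable [measurable]: "cell_mass \<in> borel_measurable borel"
proof -
  have "(\<lambda>x. (\<lambda>n. measure \<mu> (q -` {n})) (q x)) \<in> borel_measurable borel"
    by (rule measurable_compose[OF q]) simp
  then show ?thesis by (simp add: cell_mass_def[abs_def])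
qed

lemma weight_measurable [measurable]: "(\<lambda>z. weight (fst z) (snd z)) \<in> borel_measurable (borel \<Otimes>\<^sub>M borel)"
proof -
  \<comment> \<open>Writing equality of the cell indices as a countable existential makes its
    measurability evident.\<close>
  have "(\<lambda>z. weight (fst z) (snd z))
      = (\<lambda>z. if \<exists>n. q (fst z) = n \<and> q (snd z) = n then 1 / cell_mass (fst z) else 0)"
    by (auto simp: weight_def)
  then show ?thesis by (simp only:) measurable
qed

lemma nn_integral_marginal:
  assumes [measurable]: "f \<in> borel_measurable borel"
  shows "(\<integral>\<^sup>+p. f (fst p) \<partial>\<gamma>) = (\<integral>\<^sup>+x. f x \<partial>\<mu>)" "(\<integral>\<^sup>+p. f (fst p) \<partial>\<gamma>') = (\<integral>\<^sup>+x. f x \<partial>\<mu>)"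
  using nn_integral_distr[of fst \<gamma> borel f] nn_integral_distr[of fst \<gamma>' borel f] marginal by simp_all

lemma weight_measurable2 [measurable]:
  assumes [measurable]: "f \<in> borel_measurable M" "g \<in> borel_measurable M"
  shows "(\<lambda>z. weight (f z) (g z)) \<in> borel_measurable M"
proof -
  have "(\<lambda>z. (f z, g z)) \<in> M \<rightarrow>\<^sub>M borel \<Otimes>\<^sub>M borel" by measurable
  from measurable_compose[OF this weight_measurable] show ?thesis by simp
qed

lemma weight_nonneg: "0 \<le> weight x x'"
  by (simp add: weight_def cell_mass_def)

lemma weight_le: "weight x x' \<le> 1 / cell_mass x"
  by (simp add: weight_def cell_mass_def)

lemma weight_commute: "weight x x' = weight x' x"
  by (simp add: weight_def cell_mass_def)

lemma cell_in_sets: "q -` {n} \<in> sets \<mu>"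
  using measurable_sets[OF q, of "{n}"] by (simp add: sets_\<mu>)

text \<open>There are only countably many cells, so the union of those with mass zero is a null
  set.\<close>

lemma AE_cell_mass: "AE x in \<mu>. 0 < cell_mass x"
proof -
  have "AE x in \<mu>. q x = n \<longrightarrow> 0 < cell_mass x" for n
  proof (cases "measure \<mu> (q -` {n}) = 0")
    case True
    then have "q -` {n} \<in> null_sets \<mu>"
      using cell_in_sets by (simp add: null_sets_def m.emeasure_eq_measure)
    from AE_not_in[OF this] show ?thesis by eventually_elim simp
  next
    case False
    then show ?thesis by (auto simp: cell_mass_def zero_less_measure_iff)
  qed
  then have "AE x in \<mu>. \<forall>n. q x = n \<longrightarrow> 0 < cell_mass x"
    by (simp only: AE_all_countable) simp
  then show ?thesis by simp
qed

lemma AE_cell_mass_fst: "AE p in \<gamma>. 0 < cell_mass (fst p)" "AE p in \<gamma>'. 0 < cell_mass (fst p)"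
proof -
  have "AE x in distr \<gamma> borel fst. 0 < cell_mass x" "AE x in distr \<gamma>' borel fst. 0 < cell_mass x"
    unfolding marginal by (rule AE_cell_mass)+
  then show "AE p in \<gamma>. 0 < cell_mass (fst p)" "AE p in \<gamma>'. 0 < cell_mass (fst p)"
    by (auto dest!: AE_distrD[rotated])
qed

lemma nn_integral_weight_\<mu>:
  assumes "0 < cell_mass x"
  shows "(\<integral>\<^sup>+x'. ennreal (weight x x') \<partial>\<mu>) = 1"
proof -
  have "(\<integral>\<^sup>+x'. ennreal (weight x x') \<partial>\<mu>)
      = (\<integral>\<^sup>+x'. ennreal (1 / cell_mass x) * indicator (q -` {q x}) x' \<partial>\<mu>)"
    by (rule nn_integral_cong) (auto simp: weight_def indicator_def)
  also have "\<dots> = ennreal (1 / cell_mass x) * ennreal (cell_mass x)"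
    using cell_in_sets[of "q x"] by (simp add: nn_integral_cmult_indicator m.emeasure_eq_measure cell_mass_def)
  also have "\<dots> = 1" using assms by (simp flip: ennreal_mult')
  finally show ?thesis .
qed

lemma nn_integral_weight:
  assumes "0 < cell_mass x"
  shows "(\<integral>\<^sup>+p. ennreal (weight x (fst p)) \<partial>\<gamma>) = 1" "(\<integral>\<^sup>+p. ennreal (weight x (fst p)) \<partial>\<gamma>') = 1"
  using nn_integral_marginal[of "\<lambda>x'. ennreal (weight x x')"] nn_integral_weight_\<mu>[OF assms] by simp_all

section \<open>The glued measure and its marginals\<close>

lemma sets_glued [measurable_cong]: "sets glued = sets (\<gamma> \<Otimes>\<^sub>M \<gamma>')"
  by (simp add: glued_def)

lemma nn_integral_glued:
  assumes [measurable]: "f \<in> borel_measurable (\<gamma> \<Otimes>\<^sub>M \<gamma>')"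
  shows "(\<integral>\<^sup>+P. f P \<partial>glued)
    = (\<integral>\<^sup>+P. ennreal (weight (fst (fst P)) (fst (snd P))) * f P \<partial>(\<gamma> \<Otimes>\<^sub>M \<gamma>'))"
  unfolding glued_def by (rule nn_integral_density) measurable

text \<open>Integrating out the second plan leaves the total weight seen from a point, which is 1
  wherever its cell has positive mass. Hence \<open>\<gamma>\<close> is the first marginal.\<close>

lemma nn_integral_glued_fst:
  assumes [measurable]: "f \<in> borel_measurable \<gamma>"
  shows "(\<integral>\<^sup>+P. f (fst P) \<partial>glued) = (\<integral>\<^sup>+p. f p \<partial>\<gamma>)"
proof -
  have "(\<integral>\<^sup>+P. f (fst P) \<partial>glued)
      = (\<integral>\<^sup>+p. \<integral>\<^sup>+p'. ennreal (weight (fst p) (fst p')) * f p \<partial>\<gamma>' \<partial>\<gamma>)"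
    by (subst nn_integral_glued, measurable, subst g'.nn_integral_fst[symmetric]) simp_all
  also have "\<dots> = (\<integral>\<^sup>+p. f p \<partial>\<gamma>)"
  proof (rule nn_integral_cong_AE, use AE_cell_mass_fst(1) in eventually_elim)
    case (elim p)
    then show ?case by (simp add: nn_integral_multc nn_integral_weight)
  qed
  finally show ?thesis .
qed

lemma nn_integral_glued_snd:
  assumes [measurable]: "f \<in> borel_measurable \<gamma>'"
  shows "(\<integral>\<^sup>+P. f (snd P) \<partial>glued) = (\<integral>\<^sup>+p. f p \<partial>\<gamma>')"
proof -
  have "(\<integral>\<^sup>+P. f (snd P) \<partial>glued)
      = (\<integral>\<^sup>+p'. \<integral>\<^sup>+p. ennreal (weight (fst p') (fst p)) * f p' \<partial>\<gamma> \<partial>\<gamma>')"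
    by (subst nn_integral_glued, measurable, subst P.nn_integral_snd[symmetric])
      (simp_all add: weight_commute)
  also have "\<dots> = (\<integral>\<^sup>+p. f p \<partial>\<gamma>')"
  proof (rule nn_integral_cong_AE, use AE_cell_mass_fst(2) in eventually_elim)
    case (elim p)
    then show ?case by (simp add: nn_integral_multc nn_integral_weight)
  qed
  finally show ?thesis .
qed

lemma distr_glued_fst: "distr glued \<gamma> fst = \<gamma>"
proof (rule measure_eqI)
  fix A assume "A \<in> sets (distr glued \<gamma> fst)"
  then have [measurable]: "A \<in> sets \<gamma>" by simp
  have "emeasure (distr glued \<gamma> fst) A = (\<integral>\<^sup>+p. indicator A p \<partial>distr glued \<gamma> fst)" by simp
  also have "\<dots> = (\<integral>\<^sup>+P. indicator A (fst P) \<partial>glued)" by (rule nn_integral_distr) measurable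
  also have "\<dots> = (\<integral>\<^sup>+p. indicator A p \<partial>\<gamma>)" by (rule nn_integral_glued_fst) measurable
  finally show "emeasure (distr glued \<gamma> fst) A = emeasure \<gamma> A" by simp
qed simp

lemma distr_glued_snd: "distr glued \<gamma>' snd = \<gamma>'"
proof (rule measure_eqI)
  fix A assume "A \<in> sets (distr glued \<gamma>' snd)"
  then have [measurable]: "A \<in> sets \<gamma>'" by simp
  have "emeasure (distr glued \<gamma>' snd) A = (\<integral>\<^sup>+p. indicator A p \<partial>distr glued \<gamma>' snd)" by simp
  also have "\<dots> = (\<integral>\<^sup>+P. indicator A (snd P) \<partial>glued)" by (rule nn_integral_distr) measurable
  also have "\<dots> = (\<integral>\<^sup>+p. indicator A p \<partial>\<gamma>')" by (rule nn_integral_glued_snd) measurable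
  finally show "emeasure (distr glued \<gamma>' snd) A = emeasure \<gamma>' A" by simp
qed simp

lemma prob_space_glued: "prob_space glued"
proof (rule prob_spaceI)
  have "emeasure glued (space glued) = (\<integral>\<^sup>+P. (\<lambda>_. 1) (fst P) \<partial>glued)" by simp
  also have "\<dots> = (\<integral>\<^sup>+p. 1 \<partial>\<gamma>)" by (rule nn_integral_glued_fst) simp
  finally show "emeasure glued (space glued) = 1" by (simp add: g.emeasure_space_1)
qed

lemma square_integrable_glued:
  "square_integrable \<gamma> f \<Longrightarrow> square_integrable glued (\<lambda>P. f (fst P))"
  "square_integrable \<gamma>' f' \<Longrightarrow> square_integrable glued (\<lambda>P. f' (snd P))"
  using square_integrable_distr[of fst glued \<gamma> f] square_integrable_distr[of snd glued \<gamma>' f']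
  by (auto simp: distr_glued_fst distr_glued_snd dest: square_integrable_measurable)

lemma integral_glued:
  fixes f :: "'a \<times> 'a \<Rightarrow> real"
  shows "f \<in> borel_measurable \<gamma> \<Longrightarrow> (\<integral>P. f (fst P) \<partial>glued) = (\<integral>p. f p \<partial>\<gamma>)"
    and "f \<in> borel_measurable \<gamma>' \<Longrightarrow> (\<integral>P. f (snd P) \<partial>glued) = (\<integral>p. f p \<partial>\<gamma>')"
  using integral_distr[of fst glued \<gamma> f] integral_distr[of snd glued \<gamma>' f]
  by (auto simp: distr_glued_fst distr_glued_snd)

lemma AE_glued: "AE P in glued. q (fst (fst P)) = q (fst (snd P))"
  unfolding glued_def by (subst AE_density, measurable) (auto simp: weight_def)

section \<open>Cell means and Jensen's inequality\<close>

lemma integrable_weight_scaleR: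
  fixes h :: "'a \<times> 'a \<Rightarrow> 'b::euclidean_space"
  assumes h: "integrable \<gamma>' h"
  shows "integrable \<gamma>' (\<lambda>p. weight x (fst p) *\<^sub>R h p)"
proof (rule Bochner_Integration.integrable_bound)
  note borel_measurable_integrable[OF h, measurable]
  show "(\<lambda>p. weight x (fst p) *\<^sub>R h p) \<in> borel_measurable \<gamma>'" by measurable
  show "integrable \<gamma>' (\<lambda>p. (1 / cell_mass x) * norm (h p))" using h by (intro integrable_mult_right integrable_norm)
  have "0 \<le> 1 / cell_mass x" by (simp add: cell_mass_def)
  then have "norm (weight x (fst p) *\<^sub>R h p) \<le> norm ((1 / cell_mass x) * norm (h p))" for p
    using mult_right_mono[OF weight_le[of x "fst p"] norm_ge_zero[of "h p"]] weight_nonneg[of x "fst p"]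
    by (simp add: abs_mult)
  then show "AE p in \<gamma>'. norm (weight x (fst p) *\<^sub>R h p) \<le> norm ((1 / cell_mass x) * norm (h p))"
    by simp
qed

lemma cell_mean_measurable [measurable]:
  assumes [measurable]: "v \<in> borel_measurable \<gamma>'"
  shows "cell_mean v \<in> borel_measurable borel"
proof -
  have "(\<lambda>z. weight (fst z) (fst (snd z)) *\<^sub>R v (snd z)) \<in> borel_measurable (borel \<Otimes>\<^sub>M \<gamma>')"
    by measurable
  then show ?thesis
    unfolding cell_mean_def[abs_def]
    by (intro g'.borel_measurable_lebesgue_integral) (simp add: case_prod_beta')
qed

text \<open>For a cell of positive mass the weight is a probability density with respect to
  \<open>\<gamma>'\<close>. Pairing the deviation \<open>cell_mean v x - c\<close> with itself and
  applying the arithmetic-geometric mean inequality lets half of its square be absorbed.\<close>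

lemma cell_mean_Jensen:
  assumes v: "square_integrable \<gamma>' v" and x: "0 < cell_mass x"
  shows "ennreal ((norm (cell_mean v x - c))\<^sup>2)
    \<le> (\<integral>\<^sup>+p. ennreal (weight x (fst p)) * ennreal ((norm (v p - c))\<^sup>2) \<partial>\<gamma>')"
proof -
  let ?W = "\<lambda>p. weight x (fst p)"
  note square_integrable_measurable[OF v, measurable]
  have si: "square_integrable \<gamma>' (\<lambda>p. v p - c)"
    using v square_integrable_const[OF g'.finite_measure_axioms] by (rule square_integrable_diff)
  note intW = integrable_weight_scaleR[of "\<lambda>_. 1::real" x, simplified]
    and intWv = integrable_weight_scaleR[OF square_integrable_integrable[OF v g'.finite_measure_axioms], of x]
    and intWn = integrable_weight_scaleR[OF square_integrable_integrable[OF si g'.finite_measure_axioms], of x]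
    and intWs = integrable_weight_scaleR[OF square_integrableD[OF si], of x, simplified]
  have W1: "(\<integral>p. ?W p \<partial>\<gamma>') = 1"
    using nn_integral_weight(2)[OF x] nn_integral_eq_integral[OF intW] weight_nonneg
    by (simp add: ennreal_eq_1)
  let ?e = "cell_mean v x - c"
  have "?e = (\<integral>p. ?W p *\<^sub>R v p \<partial>\<gamma>') - (\<integral>p. ?W p *\<^sub>R c \<partial>\<gamma>')"
    unfolding cell_mean_def using W1 intW by simp
  also have "\<dots> = (\<integral>p. ?W p *\<^sub>R v p - ?W p *\<^sub>R c \<partial>\<gamma>')"
    using intWv intW by (intro Bochner_Integration.integral_diff[symmetric] integrable_scaleR_left)
  finally have e: "?e = (\<integral>p. ?W p *\<^sub>R (v p - c) \<partial>\<gamma>')" by (simp add: scaleR_diff_right)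
  have pt: "?W p * (?e \<bullet> (v p - c)) \<le> (1/2) * (norm ?e)\<^sup>2 * ?W p + (1/2) * (?W p * (norm (v p - c))\<^sup>2)" for p
  proof -
    have "?e \<bullet> (v p - c) \<le> norm ?e * norm (v p - c)" by (rule norm_cauchy_schwarz)
    also have "\<dots> \<le> ((norm ?e)\<^sup>2 + (norm (v p - c))\<^sup>2) / 2"
      using sum_squares_bound[of "norm ?e" "norm (v p - c)"] by simp
    finally have "?W p * (?e \<bullet> (v p - c)) \<le> ?W p * (((norm ?e)\<^sup>2 + (norm (v p - c))\<^sup>2) / 2)"
      by (intro mult_left_mono weight_nonneg)
    then show ?thesis by (simp add: field_simps)
  qed
  have "(norm ?e)\<^sup>2 = ?e \<bullet> (\<integral>p. ?W p *\<^sub>R (v p - c) \<partial>\<gamma>')"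
    unfolding e[symmetric] by (simp add: power2_norm_eq_inner)
  also have "\<dots> = (\<integral>p. ?e \<bullet> (?W p *\<^sub>R (v p - c)) \<partial>\<gamma>')"
    using intWn by (intro integral_inner_right[symmetric]) auto
  also have "\<dots> \<le> (\<integral>p. (1/2) * (norm ?e)\<^sup>2 * ?W p + (1/2) * (?W p * (norm (v p - c))\<^sup>2) \<partial>\<gamma>')"
    using pt intW intWs intWn
    by (intro integral_mono Bochner_Integration.integrable_add integrable_mult_right integrable_inner_right)
      (simp_all only: inner_scaleR_right)
  also have "\<dots> = (1/2) * (norm ?e)\<^sup>2 + (1/2) * (\<integral>p. ?W p * (norm (v p - c))\<^sup>2 \<partial>\<gamma>')"
    using intW intWs W1 by simp
  finally have "(norm ?e)\<^sup>2 \<le> (\<integral>p. ?W p * (norm (v p - c))\<^sup>2 \<partial>\<gamma>')" by simp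
  then have "ennreal ((norm ?e)\<^sup>2) \<le> (\<integral>\<^sup>+p. ennreal (?W p * (norm (v p - c))\<^sup>2) \<partial>\<gamma>')"
    using nn_integral_eq_integral[OF intWs] weight_nonneg by (simp add: ennreal_leI)
  then show ?thesis by (simp add: ennreal_mult weight_nonneg)
qed

text \<open>Jensen's inequality is applied at each \<open>x\<close> with its own constant
  \<open>c = g x\<close>; integrating over \<open>x\<close> assembles the right-hand sides into an
  integral over the glued measure.\<close>

lemma nn_integral_cell_mean:
  assumes v: "square_integrable \<gamma>' v" and [measurable]: "g \<in> borel_measurable borel"
  shows "(\<integral>\<^sup>+x. ennreal ((norm (cell_mean v x - g x))\<^sup>2) \<partial>\<mu>)
    \<le> (\<integral>\<^sup>+P. ennreal ((norm (v (snd P) - g (fst (fst P))))\<^sup>2) \<partial>glued)"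
proof -
  note square_integrable_measurable[OF v, measurable]
  have "(\<integral>\<^sup>+x. ennreal ((norm (cell_mean v x - g x))\<^sup>2) \<partial>\<mu>)
      = (\<integral>\<^sup>+p. ennreal ((norm (cell_mean v (fst p) - g (fst p)))\<^sup>2) \<partial>\<gamma>)"
    by (rule nn_integral_marginal(1)[symmetric]) measurable
  also have "\<dots> \<le> (\<integral>\<^sup>+p. \<integral>\<^sup>+p'. ennreal (weight (fst p) (fst p')) *
      ennreal ((norm (v p' - g (fst p)))\<^sup>2) \<partial>\<gamma>' \<partial>\<gamma>)"
    by (rule nn_integral_mono_AE, use AE_cell_mass_fst(1) in eventually_elim)
      (rule cell_mean_Jensen[OF v])
  also have "\<dots> = (\<integral>\<^sup>+P. ennreal ((norm (v (snd P) - g (fst (fst P))))\<^sup>2) \<partial>glued)"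
    by (subst nn_integral_glued, measurable, subst g'.nn_integral_fst[symmetric]) simp_all
  finally show ?thesis .
qed

lemma square_integrable_cell_mean:
  assumes v: "square_integrable \<gamma>' v"
  shows "square_integrable \<mu> (cell_mean v)"
  unfolding square_integrable_def
proof
  note square_integrable_measurable[OF v, measurable]
  show "cell_mean v \<in> borel_measurable \<mu>" by measurable
  have "(\<integral>\<^sup>+x. ennreal ((norm (cell_mean v x))\<^sup>2) \<partial>\<mu>)
      \<le> (\<integral>\<^sup>+P. ennreal ((norm (v (snd P)))\<^sup>2) \<partial>glued)"
    using nn_integral_cell_mean[OF v, of "\<lambda>_. 0"] by simp
  also have "\<dots> < \<infinity>"
    using square_integrableD[OF square_integrable_glued(2)[OF v]] by (simp add: integrable_iff_bounded)
  finally show "integrable \<mu> (\<lambda>x. (norm (cell_mean v x))\<^sup>2)"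
    by (intro integrableI_bounded) auto
qed

text \<open>By Fubini the second plan is integrated out first, which replaces \<open>v\<close> by
  its cell mean. The cross term of a glued cost thus becomes an integral over
  \<open>\<gamma>\<close> alone.\<close>

lemma integral_glued_inner:
  assumes u: "square_integrable \<gamma> u" and v: "square_integrable \<gamma>' v"
  shows "(\<integral>P. v (snd P) \<bullet> u (fst P) \<partial>glued) = (\<integral>p. cell_mean v (fst p) \<bullet> u p \<partial>\<gamma>)"
proof -
  note square_integrable_measurable[OF u, measurable] square_integrable_measurable[OF v, measurable]
  let ?w = "\<lambda>P. weight (fst (fst P)) (fst (snd P))"
  have mw: "?w \<in> borel_measurable (\<gamma> \<Otimes>\<^sub>M \<gamma>')" by measurable
  have mvu: "(\<lambda>P. v (snd P) \<bullet> u (fst P)) \<in> borel_measurable (\<gamma> \<Otimes>\<^sub>M \<gamma>')"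
    by (rule borel_measurable_inner) measurable
  have "integrable glued (\<lambda>P. v (snd P) \<bullet> u (fst P))"
    by (rule square_integrable_inner[OF square_integrable_glued(2)[OF v] square_integrable_glued(1)[OF u]])
  then have int: "integrable (\<gamma> \<Otimes>\<^sub>M \<gamma>') (\<lambda>P. ?w P *\<^sub>R (v (snd P) \<bullet> u (fst P)))"
    unfolding glued_def by (subst (asm) integrable_density[OF mvu mw]) (simp_all add: weight_nonneg)
  have "(\<integral>P. v (snd P) \<bullet> u (fst P) \<partial>glued) = (\<integral>P. ?w P *\<^sub>R (v (snd P) \<bullet> u (fst P)) \<partial>(\<gamma> \<Otimes>\<^sub>M \<gamma>'))"
    unfolding glued_def by (rule integral_density[OF mvu mw]) (simp add: weight_nonneg)
  also have "\<dots> = (\<integral>p. \<integral>p'. weight (fst p) (fst p') *\<^sub>R (v p' \<bullet> u p) \<partial>\<gamma>' \<partial>\<gamma>)"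
    using P.integral_fst'[OF int] by simp
  also have "\<dots> = (\<integral>p. cell_mean v (fst p) \<bullet> u p \<partial>\<gamma>)"
  proof (rule Bochner_Integration.integral_cong[OF refl])
    fix p
    have "(\<integral>p'. (weight (fst p) (fst p') *\<^sub>R v p') \<bullet> u p \<partial>\<gamma>') = cell_mean v (fst p) \<bullet> u p"
      unfolding cell_mean_def
      by (intro integral_inner_left integrable_weight_scaleR square_integrable_integrable v
          g'.finite_measure_axioms)
    then show "(\<integral>p'. weight (fst p) (fst p') *\<^sub>R (v p' \<bullet> u p) \<partial>\<gamma>') = cell_mean v (fst p) \<bullet> u p" by simp
  qed
  finally show ?thesis .
qed

end

text \<open>A point is labelled by the first member of a countable dense sequence within distance
  \<open>\<delta> / 2\<close>; points with the same label are then
  \<open>\<delta>\<close>-close.\<close>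

lemma small_cells:
  assumes "\<delta> > 0"
  obtains q :: "'a::euclidean_space \<Rightarrow> nat"
  where "q \<in> borel \<rightarrow>\<^sub>M count_space UNIV" "\<And>x y. q x = q y \<Longrightarrow> norm (x - y) \<le> \<delta>"
proof -
  obtain D :: "'a set" where D: "countable D" "\<And>X. open X \<Longrightarrow> X \<noteq> {} \<Longrightarrow> \<exists>d\<in>D. d \<in> X"
    using countable_dense_setE by metis
  define d where "d = from_nat_into D"
  have "D \<noteq> {}" using D(2)[of UNIV] by auto
  then have dD: "range d = D" unfolding d_def using D(1) by (simp add: range_from_nat_into)
  have ex: "\<exists>n. dist x (d n) < \<delta> / 2" for x
  proof -
    obtain y where "y \<in> D" "y \<in> ball x (\<delta>/2)" using D(2)[of "ball x (\<delta>/2)"] assms by auto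
    then show ?thesis using dD by (metis mem_ball rangeE)
  qed
  define q where "q x = (LEAST n. dist x (d n) < \<delta> / 2)" for x
  have qd: "dist x (d (q x)) < \<delta> / 2" for x unfolding q_def by (rule LeastI_ex[OF ex])
  have "q \<in> borel \<rightarrow>\<^sub>M count_space UNIV"
    unfolding q_def by measurable
  moreover have "norm (x - y) \<le> \<delta>" if "q x = q y" for x y
    using qd[of x] qd[of y] that dist_triangle_half_l[of x "d (q x)" \<delta> y] by (simp add: dist_norm)
  ultimately show ?thesis by (rule that)
qed

text \<open>The map \<open>\<xi>\<close> approximates the barycentric projection of \<open>\<gamma>'\<close>, shifted by the identity. It
  plays the role of \<open>T - I\<close> for the optimal map \<open>T\<close> from \<open>\<mu>\<close> to \<open>\<nu>\<close>, and it must not depend on the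
  competitor \<open>\<gamma>\<close>.\<close>

lemma approximate_barycenter:
  fixes \<mu> \<nu> :: "'a::euclidean_space measure"
  assumes \<mu>: "\<mu> \<in> P2" and \<nu>: "\<nu> \<in> P2" and \<gamma>': "\<gamma>' \<in> couplings \<mu> \<nu>" and \<delta>: "\<delta> > 0"
  obtains \<xi> where "square_integrable \<mu> \<xi>"
    "\<And>\<sigma> \<gamma>. \<sigma> \<in> P2 \<Longrightarrow> \<gamma> \<in> couplings \<mu> \<sigma> \<Longrightarrow> (W2 \<nu> \<sigma>)\<^sup>2 \<le> transport_cost \<gamma>'
       + 2 * (\<integral>z. \<xi> (fst z) \<bullet> (fst z - snd z) \<partial>\<gamma>) + transport_cost \<gamma>
       + \<delta> * (2 + \<delta> + transport_cost \<gamma>' + transport_cost \<gamma>)"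
    "\<And>g L. 0 \<le> L \<Longrightarrow> g \<in> borel_measurable borel \<Longrightarrow> square_integrable \<mu> g \<Longrightarrow>
       (\<And>x y. norm (g x - g y) \<le> L * norm (x - y)) \<Longrightarrow>
       (\<integral>x. (norm (\<xi> x - g x))\<^sup>2 \<partial>\<mu>)
         \<le> 2 * (\<integral>z. (norm (snd z - fst z - g (fst z)))\<^sup>2 \<partial>\<gamma>') + 2 * (L * \<delta>)\<^sup>2"
proof -
  obtain q :: "'a \<Rightarrow> nat" where q: "q \<in> borel \<rightarrow>\<^sub>M count_space UNIV"
    and q_close: "\<And>x y. q x = q y \<Longrightarrow> norm (x - y) \<le> \<delta>"
    using small_cells[OF \<delta>] by blast
  have gl: "cell_gluing \<gamma> \<gamma>' \<mu> q" if "\<gamma> \<in> couplings \<mu> \<sigma>" for \<gamma> \<sigma>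
    using couplings_D[OF that] couplings_D[OF \<gamma>'] q
    unfolding cell_gluing_def borel_prod by blast
  let ?v = "\<lambda>z. snd z - fst z :: 'a"
  have v: "square_integrable \<gamma>' ?v"
    using square_integrable_scaleR[OF square_integrable_displacement[OF \<mu> \<nu> \<gamma>'], of "-1"] by simp
  \<comment> \<open>Gluing \<open>\<gamma>'\<close> with itself provides the cell mean before any
    competitor is chosen, and later the measure for the norm estimate.\<close>
  interpret self: cell_gluing \<gamma>' \<gamma>' \<mu> q by (rule gl[OF \<gamma>'])
  show ?thesis
  proof (rule that[of "self.cell_mean ?v"])
    show "square_integrable \<mu> (self.cell_mean ?v)" by (rule self.square_integrable_cell_mean[OF v])
  next
    fix \<sigma> \<gamma> assume \<sigma>: "\<sigma> \<in> P2" and \<gamma>: "\<gamma> \<in> couplings \<mu> \<sigma>"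
    interpret cell_gluing \<gamma> \<gamma>' \<mu> q by (rule gl[OF \<gamma>])
    interpret G: prob_space glued by (rule prob_space_glued)
    let ?u = "\<lambda>z. fst z - snd z :: 'a"
    have u: "square_integrable \<gamma> ?u" by (rule square_integrable_displacement[OF \<mu> \<sigma> \<gamma>])
    let ?plan = "distr glued borel (\<lambda>P. (snd (snd P), snd (fst P)))"
    have meas: "(\<lambda>P. (snd (snd P), snd (fst P))) \<in> borel_measurable glued"
      unfolding borel_prod[symmetric] by measurable
    have plan: "?plan \<in> couplings \<nu> \<sigma>"
      unfolding couplings_def
    proof (intro CollectI conjI)
      show "prob_space ?plan" by (rule G.prob_space_distr[OF meas])
      have "distr ?plan borel fst = distr (distr glued \<gamma>' snd) borel snd"
        by (subst distr_distr[OF _ meas], simp add: borel_prod[symmetric]) (subst distr_distr, auto simp: comp_def)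
      then show "distr ?plan borel fst = \<nu>"
        using couplings_D(4)[OF \<gamma>'] by (simp add: distr_glued_snd)
      have "distr ?plan borel snd = distr (distr glued \<gamma> fst) borel snd"
        by (subst distr_distr[OF _ meas], simp add: borel_prod[symmetric]) (subst distr_distr, auto simp: comp_def)
      then show "distr ?plan borel snd = \<sigma>"
        using couplings_D(4)[OF \<gamma>] by (simp add: distr_glued_fst)
    qed simp
    let ?a = "\<lambda>P. ?v (snd P)" and ?b = "\<lambda>P. ?u (fst P)"
    have a: "square_integrable glued ?a" and b: "square_integrable glued ?b"
      using square_integrable_glued(1)[OF u] square_integrable_glued(2)[OF v] by auto
    \<comment> \<open>Here \<open>a\<close> and \<open>b\<close> are the displacements along the two
      plans and \<open>d\<close> is the mismatch of the first coordinates, so that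
      \<open>a + b + d\<close> is the displacement of the composed plan. The cross terms with
      \<open>d\<close> cost multiples of \<open>\<delta>\<close>.\<close>
    have pt: "(norm (a + b + d))\<^sup>2 \<le> (1 + \<delta>) * (norm a)\<^sup>2 + 2 * (a \<bullet> b) + (1 + \<delta>) * (norm b)\<^sup>2
        + \<delta> * (2 + \<delta>)" if "norm d \<le> \<delta>" for a b d :: 'a
    proof -
      have d: "2 * \<bar>d \<bullet> c\<bar> \<le> \<delta> * (1 + (norm c)\<^sup>2)" for c
      proof -
        have "2 * \<bar>d \<bullet> c\<bar> \<le> 2 * (norm d * norm c)" using Cauchy_Schwarz_ineq2[of d c] by simp
        also have "\<dots> \<le> \<delta> * (2 * norm c)" using mult_right_mono[OF that, of "norm c"] by simp
        also have "\<dots> \<le> \<delta> * (1 + (norm c)\<^sup>2)"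
          using \<delta> sum_squares_bound[of 1 "norm c"] by (intro mult_left_mono) auto
        finally show ?thesis .
      qed
      have "(norm d)\<^sup>2 \<le> \<delta>\<^sup>2" using that by (intro power_mono) auto
      moreover have "(norm (a + b + d))\<^sup>2
          = (norm a)\<^sup>2 + 2 * (a \<bullet> b) + (norm b)\<^sup>2 + 2 * (d \<bullet> a) + 2 * (d \<bullet> b) + (norm d)\<^sup>2"
        by (simp add: power2_norm_eq_inner inner_add_left inner_add_right inner_commute)
      moreover have "2 * (d \<bullet> a) \<le> \<delta> * (1 + (norm a)\<^sup>2)" "2 * (d \<bullet> b) \<le> \<delta> * (1 + (norm b)\<^sup>2)"
        using d[of a] d[of b] by linarith+
      ultimately show ?thesis by (simp add: algebra_simps power2_eq_square)
    qed
    have "(W2 \<nu> \<sigma>)\<^sup>2 \<le> transport_cost ?plan" by (rule W2_power2_le[OF \<nu> \<sigma> plan])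
    also have "\<dots> = (\<integral>P. (norm (snd (snd P) - snd (fst P)))\<^sup>2 \<partial>glued)"
      unfolding transport_cost_def by (subst integral_distr[OF meas]) (auto simp: borel_prod[symmetric])
    also have "\<dots> \<le> (\<integral>P. (1 + \<delta>) * (norm (?a P))\<^sup>2 + 2 * (?a P \<bullet> ?b P) + (1 + \<delta>) * (norm (?b P))\<^sup>2
        + \<delta> * (2 + \<delta>) \<partial>glued)"
    proof (rule integral_mono_AE)
      show "integrable glued (\<lambda>P. (norm (snd (snd P) - snd (fst P)))\<^sup>2)"
      proof (rule square_integrableD)
        have "square_integrable glued (\<lambda>P. snd (snd P))" "square_integrable glued (\<lambda>P. snd (fst P))"
          using square_integrable_glued(1)[OF square_integrable_coupling(2)[OF \<gamma> P2_D(3)[OF \<sigma>]]]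
            square_integrable_glued(2)[OF square_integrable_coupling(2)[OF \<gamma>' P2_D(3)[OF \<nu>]]] by auto
        then show "square_integrable glued (\<lambda>P. snd (snd P) - snd (fst P))" by (rule square_integrable_diff)
      qed
      show "integrable glued (\<lambda>P. (1 + \<delta>) * (norm (?a P))\<^sup>2 + 2 * (?a P \<bullet> ?b P) + (1 + \<delta>) * (norm (?b P))\<^sup>2
        + \<delta> * (2 + \<delta>))"
        by (intro Bochner_Integration.integrable_add integrable_mult_right square_integrableD a b
            square_integrable_inner G.integrable_const)
      show "AE P in glued. (norm (snd (snd P) - snd (fst P)))\<^sup>2 \<le> (1 + \<delta>) * (norm (?a P))\<^sup>2
          + 2 * (?a P \<bullet> ?b P) + (1 + \<delta>) * (norm (?b P))\<^sup>2 + \<delta> * (2 + \<delta>)"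
        using AE_glued
      proof eventually_elim
        case (elim P)
        have "norm (fst (snd P) - fst (fst P)) \<le> \<delta>" using q_close elim by simp
        from pt[OF this, of "?a P" "?b P"] show ?case by simp
      qed
    qed
    also have "\<dots> = (1 + \<delta>) * (\<integral>P. (norm (?a P))\<^sup>2 \<partial>glued) + 2 * (\<integral>P. ?a P \<bullet> ?b P \<partial>glued)
        + (1 + \<delta>) * (\<integral>P. (norm (?b P))\<^sup>2 \<partial>glued) + \<delta> * (2 + \<delta>)"
      using square_integrableD[OF a] square_integrableD[OF b] square_integrable_inner[OF a b]
      by (simp add: G.prob_space)
    also have "(\<integral>P. (norm (?a P))\<^sup>2 \<partial>glued) = transport_cost \<gamma>'"
      using integral_glued(2)[of "\<lambda>z. (norm (?v z))\<^sup>2"] by (simp add: transport_cost_def norm_minus_commute)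
    also have "(\<integral>P. (norm (?b P))\<^sup>2 \<partial>glued) = transport_cost \<gamma>"
      using integral_glued(1)[of "\<lambda>z. (norm (?u z))\<^sup>2"] by (simp add: transport_cost_def)
    \<comment> \<open>The first plan does not occur in the definition of \<open>cell_mean\<close>,
      so the interpretations for \<open>\<gamma>\<close> and for \<open>\<gamma>'\<close> yield the
      same map.\<close>
    also have "(\<integral>P. ?a P \<bullet> ?b P \<partial>glued) = (\<integral>z. self.cell_mean ?v (fst z) \<bullet> ?u z \<partial>\<gamma>)"
      by (rule integral_glued_inner[OF u v])
    finally show "(W2 \<nu> \<sigma>)\<^sup>2 \<le> transport_cost \<gamma>'
       + 2 * (\<integral>z. self.cell_mean ?v (fst z) \<bullet> (fst z - snd z) \<partial>\<gamma>) + transport_cost \<gamma>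
       + \<delta> * (2 + \<delta> + transport_cost \<gamma>' + transport_cost \<gamma>)"
      by (simp add: algebra_simps)
  next
    fix g :: "'a \<Rightarrow> 'a" and L :: real
    assume L: "0 \<le> L" and [measurable]: "g \<in> borel_measurable borel" and g: "square_integrable \<mu> g"
      and lip: "\<And>x y. norm (g x - g y) \<le> L * norm (x - y)"
    interpret G: prob_space self.glued by (rule self.prob_space_glued)
    let ?r = "\<lambda>z. snd z - fst z - g (fst z)"
    have r: "square_integrable \<gamma>' ?r"
      using v square_integrable_coupling(1)[OF \<gamma>' g] by (rule square_integrable_diff)
    have rg: "square_integrable self.glued (\<lambda>P. ?r (snd P))" by (rule self.square_integrable_glued(2)[OF r])
    have int: "integrable self.glued (\<lambda>P. 2 * (norm (?r (snd P)))\<^sup>2 + 2 * (L * \<delta>)\<^sup>2)"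
      by (intro Bochner_Integration.integrable_add integrable_mult_right square_integrableD rg G.integrable_const)
    have si: "square_integrable \<mu> (\<lambda>x. self.cell_mean ?v x - g x)"
      by (rule square_integrable_diff[OF self.square_integrable_cell_mean[OF v] g])
    have "ennreal (\<integral>x. (norm (self.cell_mean ?v x - g x))\<^sup>2 \<partial>\<mu>)
        = (\<integral>\<^sup>+x. ennreal ((norm (self.cell_mean ?v x - g x))\<^sup>2) \<partial>\<mu>)"
      using square_integrableD[OF si] by (simp add: nn_integral_eq_integral)
    also have "\<dots> \<le> (\<integral>\<^sup>+P. ennreal ((norm (?v (snd P) - g (fst (fst P))))\<^sup>2) \<partial>self.glued)"
      by (rule self.nn_integral_cell_mean[OF v]) measurable
    also have "\<dots> \<le> (\<integral>\<^sup>+P. ennreal (2 * (norm (?r (snd P)))\<^sup>2 + 2 * (L * \<delta>)\<^sup>2) \<partial>self.glued)"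
    proof (rule nn_integral_mono_AE, use self.AE_glued in eventually_elim)
      case (elim P)
      \<comment> \<open>Jensen's inequality evaluates \<open>g\<close> at the first coordinate of
        the other copy; moving it to the matching copy within the same cell costs at most
        \<open>L * \<delta>\<close>.\<close>
      have "norm (g (fst (snd P)) - g (fst (fst P))) \<le> L * norm (fst (snd P) - fst (fst P))" by (rule lip)
      also have "\<dots> \<le> L * \<delta>" using q_close[of "fst (snd P)" "fst (fst P)"] elim L by (intro mult_left_mono) auto
      finally have "(norm (g (fst (snd P)) - g (fst (fst P))))\<^sup>2 \<le> (L * \<delta>)\<^sup>2" by (rule power_mono) simp
      then show ?case
        using norm_add_sq_le[of "?r (snd P)" "g (fst (snd P)) - g (fst (fst P))"]
        by (intro ennreal_leI) simp
    qed
    also have "\<dots> = ennreal (\<integral>P. 2 * (norm (?r (snd P)))\<^sup>2 + 2 * (L * \<delta>)\<^sup>2 \<partial>self.glued)"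
      by (rule nn_integral_eq_integral[OF int]) simp
    also have "(\<integral>P. 2 * (norm (?r (snd P)))\<^sup>2 + 2 * (L * \<delta>)\<^sup>2 \<partial>self.glued)
        = 2 * (\<integral>P. (norm (?r (snd P)))\<^sup>2 \<partial>self.glued) + 2 * (L * \<delta>)\<^sup>2"
      using square_integrableD[OF rg] by (simp add: G.prob_space)
    also have "(\<integral>P. (norm (?r (snd P)))\<^sup>2 \<partial>self.glued) = (\<integral>z. (norm (?r z))\<^sup>2 \<partial>\<gamma>')"
      by (rule self.integral_glued(2)) measurable
    finally show "(\<integral>x. (norm (self.cell_mean ?v x - g x))\<^sup>2 \<partial>\<mu>)
         \<le> 2 * (\<integral>z. (norm (snd z - fst z - g (fst z)))\<^sup>2 \<partial>\<gamma>') + 2 * (L * \<delta>)\<^sup>2"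
      by (subst (asm) ennreal_le_iff) auto
  qed
qed

section \<open>One step of the scheme\<close>

lemma square_integrable_cong_measurable:
  "sets \<mu> = sets borel \<Longrightarrow> square_integrable \<mu> f \<Longrightarrow> f \<in> borel_measurable borel"
  using square_integrable_measurable borel_measurable_cong_borel by blast

lemma integral_coupling:
  fixes f :: "'a::euclidean_space \<Rightarrow> real"
  assumes "\<gamma> \<in> couplings \<mu> \<nu>"
  shows "f \<in> borel_measurable borel \<Longrightarrow> (\<integral>z. f (fst z) \<partial>\<gamma>) = (\<integral>x. f x \<partial>\<mu>)"
    and "f \<in> borel_measurable borel \<Longrightarrow> (\<integral>z. f (snd z) \<partial>\<gamma>) = (\<integral>x. f x \<partial>\<nu>)"
    and "f \<in> borel_measurable borel \<Longrightarrow> integrable \<mu> f \<Longrightarrow> integrable \<gamma> (\<lambda>z. f (fst z))"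
    and "f \<in> borel_measurable borel \<Longrightarrow> integrable \<nu> f \<Longrightarrow> integrable \<gamma> (\<lambda>z. f (snd z))"
proof -
  note c = couplings_D[OF assms]
  show "f \<in> borel_measurable borel \<Longrightarrow> (\<integral>z. f (fst z) \<partial>\<gamma>) = (\<integral>x. f x \<partial>\<mu>)"
    using integral_distr[OF c(6), of f] unfolding c(3) by simp
  show "f \<in> borel_measurable borel \<Longrightarrow> (\<integral>z. f (snd z) \<partial>\<gamma>) = (\<integral>x. f x \<partial>\<nu>)"
    using integral_distr[OF c(7), of f] unfolding c(4) by simp
  show "f \<in> borel_measurable borel \<Longrightarrow> integrable \<mu> f \<Longrightarrow> integrable \<gamma> (\<lambda>z. f (fst z))"
    using integrable_distr_eq[OF c(6), of f] unfolding c(3) by simp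
  show "f \<in> borel_measurable borel \<Longrightarrow> integrable \<nu> f \<Longrightarrow> integrable \<gamma> (\<lambda>z. f (snd z))"
    using integrable_distr_eq[OF c(7), of f] unfolding c(4) by simp
qed

text \<open>The plan \<open>\<pi>\<close> is the image of \<open>\<gamma>\<close> under
  \<open>R\<close> on the first coordinate. The swapped image plan starts from
  \<open>\<rho>\<close>, the orientation required for a barycentric projection at
  \<open>\<rho>\<close>.\<close>

lemma pull_back_coupling:
  fixes S R :: "'a::euclidean_space \<Rightarrow> 'a"
  assumes sets_\<mu>: "sets \<mu> = sets borel" and S: "S \<in> borel_measurable borel" and R: "R \<in> borel_measurable borel"
    and RS: "\<And>x. R (S x) = x" and \<gamma>: "\<gamma> \<in> couplings (distr \<mu> borel S) \<rho>"
  obtains \<pi> where "\<pi> \<in> couplings \<mu> \<rho>"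
    "distr \<pi> borel (\<lambda>z. (snd z, S (fst z))) \<in> couplings \<rho> (distr \<mu> borel S)"
    "transport_cost \<gamma> = (\<integral>z. (norm (S (fst z) - snd z))\<^sup>2 \<partial>\<pi>)"
proof -
  note c = couplings_D[OF \<gamma>]
  have [measurable_cong]: "sets \<gamma> = sets (borel \<Otimes>\<^sub>M borel)" using c(2) by (simp only: borel_prod)
  note [measurable_cong] = sets_\<mu>
  note [measurable] = S R
  interpret prob_space \<gamma> by (fact c)
  have T: "(\<lambda>z. (R (fst z), snd z)) \<in> borel_measurable \<gamma>" unfolding borel_prod[symmetric] by measurable
  let ?\<pi> = "distr \<gamma> borel (\<lambda>z. (R (fst z), snd z))"
  \<comment> \<open>\<open>S\<close> inverts \<open>R\<close> only on the range of \<open>S\<close>;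
    this suffices almost everywhere, because the first marginal of \<open>\<gamma>\<close> is a
    pushforward by \<open>S\<close>.\<close>
  have SR: "AE z in \<gamma>. S (R (fst z)) = fst z"
  proof -
    have "AE x in distr \<mu> borel S. S (R x) = x"
      by (subst AE_distr_iff) (auto simp: RS)
    then have "AE x in distr \<gamma> borel fst. S (R x) = x" unfolding c(3) .
    then show ?thesis by (rule AE_distrD[rotated]) measurable
  qed
  have fstb: "fst \<in> borel_measurable (borel :: ('a \<times> 'a) measure)"
    and sndb: "snd \<in> borel_measurable (borel :: ('a \<times> 'a) measure)"
    unfolding borel_prod[symmetric] by measurable
  have \<pi>: "?\<pi> \<in> couplings \<mu> \<rho>"
    unfolding couplings_def
  proof (intro CollectI conjI)
    show "prob_space ?\<pi>" by (rule prob_space_distr[OF T])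
    have "distr ?\<pi> borel fst = distr (distr \<gamma> borel fst) borel R"
      unfolding distr_distr[OF fstb T] distr_distr[OF R c(6)] by (simp add: comp_def)
    also have "\<dots> = distr \<mu> borel (\<lambda>x. x)"
      unfolding c(3) by (subst distr_distr) (auto simp: comp_def RS)
    also have "\<dots> = \<mu>"
      by (rule distr_id2) (simp add: sets_\<mu>)
    finally show "distr ?\<pi> borel fst = \<mu>" .
    show "distr ?\<pi> borel snd = \<rho>"
      unfolding distr_distr[OF sndb T] using c(4) by (simp add: comp_def)
  qed simp
  interpret p: prob_space ?\<pi> by (rule prob_space_distr[OF T])
  have T': "(\<lambda>z. (snd z, S (fst z))) \<in> borel_measurable ?\<pi>"
    unfolding measurable_distr_eq1 borel_prod[symmetric] by measurable
  have "distr ?\<pi> borel (\<lambda>z. (snd z, S (fst z))) \<in> couplings \<rho> (distr \<mu> borel S)"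
    unfolding couplings_def
  proof (intro CollectI conjI)
    show "prob_space (distr ?\<pi> borel (\<lambda>z. (snd z, S (fst z))))" by (rule p.prob_space_distr[OF T'])
    show "distr (distr ?\<pi> borel (\<lambda>z. (snd z, S (fst z)))) borel fst = \<rho>"
      unfolding distr_distr[OF fstb T'] using couplings_D(4)[OF \<pi>] by (simp add: comp_def)
    have "distr (distr ?\<pi> borel (\<lambda>z. (snd z, S (fst z)))) borel snd = distr (distr ?\<pi> borel fst) borel S"
      unfolding distr_distr[OF sndb T'] distr_distr[OF S couplings_D(6)[OF \<pi>]] by (simp add: comp_def)
    then show "distr (distr ?\<pi> borel (\<lambda>z. (snd z, S (fst z)))) borel snd = distr \<mu> borel S"
      unfolding couplings_D(3)[OF \<pi>] .
  qed simp
  moreover have "transport_cost \<gamma> = (\<integral>z. (norm (S (fst z) - snd z))\<^sup>2 \<partial>?\<pi>)"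
  proof -
    have m: "(\<lambda>z. (norm (S (fst z) - snd z))\<^sup>2) \<in> borel_measurable (borel :: ('a \<times> 'a) measure)"
      unfolding borel_prod[symmetric] by measurable
    have "(\<integral>z. (norm (S (fst z) - snd z))\<^sup>2 \<partial>?\<pi>) = (\<integral>z. (norm (S (R (fst z)) - snd z))\<^sup>2 \<partial>\<gamma>)"
      by (subst integral_distr[OF T m]) simp
    also have "\<dots> = transport_cost \<gamma>"
      unfolding transport_cost_def
      by (rule integral_cong_AE, measurable, use SR in eventually_elim) simp
    finally show ?thesis by simp
  qed
  ultimately show ?thesis using that[OF \<pi>] by blast
qed

lemma L2_inner_tendsto:
  assumes f: "\<And>n. square_integrable M (f n)" and g: "square_integrable M g" and u: "square_integrable M u"
    and lim: "(\<lambda>n. \<integral>x. (norm (f n x - g x))\<^sup>2 \<partial>M) \<longlonglongrightarrow> 0"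
  shows "(\<lambda>n. \<integral>x. f n x \<bullet> u x \<partial>M) \<longlonglongrightarrow> (\<integral>x. g x \<bullet> u x \<partial>M)"
proof (rule LIMSEQ_I)
  fix e :: real assume e: "0 < e"
  let ?D = "\<lambda>n. \<integral>x. (norm (f n x - g x))\<^sup>2 \<partial>M"
  let ?U = "\<integral>x. (norm (u x))\<^sup>2 \<partial>M"
  have U: "0 \<le> ?U" by simp
  \<comment> \<open>The parameter of Young's inequality: it keeps \<open>s * ?U\<close> below
    \<open>e / 2\<close>, and is fixed before \<open>n\<close> is taken large enough to make
    \<open>?D n / s\<close> smaller than \<open>e / 2\<close>.\<close>
  define s where "s = e / 2 / (?U + 1)"
  have s: "0 < s" unfolding s_def using e U by (intro divide_pos_pos add_nonneg_pos) auto
  have "?U + 1 \<noteq> 0" using U by linarith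
  then have "s * (?U + 1) = e / 2" by (metis nonzero_divide_eq_eq s_def)
  then have sU: "s * ?U < e / 2" using s by (simp add: distrib_left)
  have bound: "\<bar>(\<integral>x. f n x \<bullet> u x \<partial>M) - (\<integral>x. g x \<bullet> u x \<partial>M)\<bar> \<le> s * ?U + ?D n / s" for n
  proof -
    have pt: "\<bar>a \<bullet> b\<bar> \<le> s * (norm b)\<^sup>2 + (1/s) * (norm a)\<^sup>2" for a b :: 'b
      using abs_inner_le_norm_sq[of "(1 / sqrt s) *\<^sub>R a" "sqrt s *\<^sub>R b"] s
      by (simp add: power_mult_distrib power_divide)
    have fg: "square_integrable M (\<lambda>x. f n x - g x)" using f g by (rule square_integrable_diff)
    have "(\<integral>x. f n x \<bullet> u x \<partial>M) - (\<integral>x. g x \<bullet> u x \<partial>M) = (\<integral>x. (f n x - g x) \<bullet> u x \<partial>M)"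
      using square_integrable_inner[OF f u] square_integrable_inner[OF g u]
      by (simp add: inner_diff_left)
    also have "\<bar>\<dots>\<bar> \<le> (\<integral>x. \<bar>(f n x - g x) \<bullet> u x\<bar> \<partial>M)"
      by (rule integral_abs_bound)
    also have "\<dots> \<le> (\<integral>x. s * (norm (u x))\<^sup>2 + (1/s) * (norm (f n x - g x))\<^sup>2 \<partial>M)"
      by (intro integral_mono pt integrable_abs square_integrable_inner[OF fg u]
          Bochner_Integration.integrable_add integrable_mult_right square_integrableD[OF fg] square_integrableD[OF u])
    also have "\<dots> = s * ?U + ?D n / s"
      using square_integrableD[OF fg] square_integrableD[OF u] by simp
    finally show ?thesis .
  qed
  have "\<forall>\<^sub>F n in sequentially. ?D n < s * (e / 2)"
    using lim s e by (intro order_tendstoD(2)) auto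
  then obtain N where N: "\<And>n. n \<ge> N \<Longrightarrow> ?D n < s * (e / 2)"
    by (auto simp: eventually_sequentially)
  show "\<exists>N. \<forall>n\<ge>N. norm ((\<integral>x. f n x \<bullet> u x \<partial>M) - (\<integral>x. g x \<bullet> u x \<partial>M)) < e"
  proof (intro exI[of _ N] allI impI)
    fix n assume "N \<le> n"
    then have "?D n / s < e / 2" using N[of n] s by (simp add: field_simps)
    then show "norm ((\<integral>x. f n x \<bullet> u x \<partial>M) - (\<integral>x. g x \<bullet> u x \<partial>M)) < e"
      using bound[of n] sU unfolding real_norm_def by linarith
  qed
qed

text \<open>The inequality is affine in \<open>\<zeta>\<close>, so its solutions with error \<open>\<epsilon>\<close> form closed convex sets
  that decrease with \<open>\<epsilon>\<close>.\<close>

lemma W2_subgradient: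
  fixes \<nu> \<rho> :: "'a::euclidean_space measure"
  assumes \<nu>: "\<nu> \<in> P2" and \<rho>: "\<rho> \<in> P2" and c: "square_integrable \<rho> c"
    and approx: "\<And>\<epsilon>. 0 < \<epsilon> \<Longrightarrow> \<exists>\<zeta>. square_integrable \<rho> \<zeta> \<and> (\<integral>x. (norm (\<zeta> x))\<^sup>2 \<partial>\<rho>) \<le> R \<and>
        (\<forall>\<sigma>\<in>P2. \<forall>\<gamma>\<in>couplings \<rho> \<sigma>. (W2 \<nu> \<sigma>)\<^sup>2 \<le> (W2 \<nu> \<rho>)\<^sup>2
          + \<kappa> * (\<integral>z. (\<zeta> (fst z) + c (fst z)) \<bullet> (fst z - snd z) \<partial>\<gamma>) + transport_cost \<gamma>
          + \<epsilon> * (1 + transport_cost \<gamma>))"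
  obtains \<zeta> where "square_integrable \<rho> \<zeta>" "(\<integral>x. (norm (\<zeta> x))\<^sup>2 \<partial>\<rho>) \<le> R"
    "\<And>\<sigma> \<gamma>. \<sigma> \<in> P2 \<Longrightarrow> \<gamma> \<in> couplings \<rho> \<sigma> \<Longrightarrow> (W2 \<nu> \<sigma>)\<^sup>2 \<le> (W2 \<nu> \<rho>)\<^sup>2
       + \<kappa> * (\<integral>z. (\<zeta> (fst z) + c (fst z)) \<bullet> (fst z - snd z) \<partial>\<gamma>) + transport_cost \<gamma>"
proof -
  note p = P2_D[OF \<rho>]
  let ?I = "\<lambda>\<zeta> \<gamma>. \<integral>z. (\<zeta> (fst z) + c (fst z)) \<bullet> (fst z - snd z) \<partial>\<gamma>"
  \<comment> \<open>The error levels \<open>1 / Suc k\<close> decrease to 0, so a map lying in every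
    \<open>K k\<close> satisfies the inequality without error.\<close>
  define K where "K k = {\<zeta>. square_integrable \<rho> \<zeta> \<and> (\<forall>\<sigma>\<in>P2. \<forall>\<gamma>\<in>couplings \<rho> \<sigma>. (W2 \<nu> \<sigma>)\<^sup>2 \<le> (W2 \<nu> \<rho>)\<^sup>2
          + \<kappa> * ?I \<zeta> \<gamma> + transport_cost \<gamma> + 1 / Suc k * (1 + transport_cost \<gamma>))}" for k
  have KI: "\<zeta> \<in> K k" if "square_integrable \<rho> \<zeta>" "\<And>\<sigma> \<gamma>. \<sigma> \<in> P2 \<Longrightarrow> \<gamma> \<in> couplings \<rho> \<sigma> \<Longrightarrow> (W2 \<nu> \<sigma>)\<^sup>2 \<le> (W2 \<nu> \<rho>)\<^sup>2
          + \<kappa> * ?I \<zeta> \<gamma> + transport_cost \<gamma> + 1 / Suc k * (1 + transport_cost \<gamma>)" for \<zeta> k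
    using that by (auto simp: K_def)
  have KD: "(W2 \<nu> \<sigma>)\<^sup>2 \<le> (W2 \<nu> \<rho>)\<^sup>2 + \<kappa> * ?I \<zeta> \<gamma> + transport_cost \<gamma> + 1 / Suc k * (1 + transport_cost \<gamma>)"
    if "\<zeta> \<in> K k" "\<sigma> \<in> P2" "\<gamma> \<in> couplings \<rho> \<sigma>" for \<zeta> k \<sigma> \<gamma>
    using that by (auto simp: K_def)
  have si: "square_integrable \<rho> \<zeta>" if "\<zeta> \<in> K k" for \<zeta> k using that by (simp add: K_def)
  have u: "square_integrable \<gamma> (\<lambda>z. fst z - snd z)" if "\<sigma> \<in> P2" "\<gamma> \<in> couplings \<rho> \<sigma>" for \<sigma> \<gamma>
    by (rule square_integrable_displacement[OF \<rho> that])
  have sc: "square_integrable \<gamma> (\<lambda>z. \<zeta> (fst z) + c (fst z))"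
    if "square_integrable \<rho> \<zeta>" "\<gamma> \<in> couplings \<rho> \<sigma>" for \<zeta> \<gamma> \<sigma>
    by (intro square_integrable_add square_integrable_coupling(1)[OF that(2)] that(1) c)
  obtain \<zeta> where \<zeta>: "\<And>k. \<zeta> \<in> K k" "(\<integral>x. (norm (\<zeta> x))\<^sup>2 \<partial>\<rho>) \<le> R"
  proof (rule L2_nested_convex_inter[OF p(1), of K R])
    show "square_integrable \<rho> f" if "f \<in> K k" for k f using si that by blast
    show "K j \<subseteq> K k" if "k \<le> j" for k j
    proof
      fix \<zeta> assume z: "\<zeta> \<in> K j"
      show "\<zeta> \<in> K k"
      proof (rule KI[OF si[OF z]])
        fix \<sigma> \<gamma> assume *: "\<sigma> \<in> P2" "\<gamma> \<in> couplings \<rho> \<sigma>"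
        have "1 / real (Suc j) \<le> 1 / real (Suc k)" using that by (intro divide_left_mono) auto
        then have "1 / Suc j * (1 + transport_cost \<gamma>) \<le> 1 / Suc k * (1 + transport_cost \<gamma>)"
          using transport_cost_nonneg[of \<gamma>] by (intro mult_right_mono) auto
        then show "(W2 \<nu> \<sigma>)\<^sup>2 \<le> (W2 \<nu> \<rho>)\<^sup>2 + \<kappa> * ?I \<zeta> \<gamma> + transport_cost \<gamma> + 1 / Suc k * (1 + transport_cost \<gamma>)"
          using KD[OF z *] by linarith
      qed
    qed
    show "(\<lambda>x. (1/2) *\<^sub>R (f x + g x)) \<in> K k" if fg: "f \<in> K k" "g \<in> K k" for k f g
    proof (rule KI)
      show "square_integrable \<rho> (\<lambda>x. (1/2) *\<^sub>R (f x + g x))"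
        by (intro square_integrable_scaleR square_integrable_add si[OF fg(1)] si[OF fg(2)])
      fix \<sigma> \<gamma> assume *: "\<sigma> \<in> P2" "\<gamma> \<in> couplings \<rho> \<sigma>"
      have i: "integrable \<gamma> (\<lambda>z. (f (fst z) + c (fst z)) \<bullet> (fst z - snd z))"
        "integrable \<gamma> (\<lambda>z. (g (fst z) + c (fst z)) \<bullet> (fst z - snd z))"
        by (intro square_integrable_inner sc[OF _ *(2)] u[OF *] si[OF fg(1)] si[OF fg(2)])+
      have "?I (\<lambda>x. (1/2) *\<^sub>R (f x + g x)) \<gamma> = (\<integral>z. (1/2) * ((f (fst z) + c (fst z)) \<bullet> (fst z - snd z))
          + (1/2) * ((g (fst z) + c (fst z)) \<bullet> (fst z - snd z)) \<partial>\<gamma>)"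
        by (rule Bochner_Integration.integral_cong) (simp_all add: inner_add_left field_simps)
      also have "\<dots> = (1/2) * ?I f \<gamma> + (1/2) * ?I g \<gamma>"
        using i by simp
      finally have "\<kappa> * ?I (\<lambda>x. (1/2) *\<^sub>R (f x + g x)) \<gamma> = (\<kappa> * ?I f \<gamma> + \<kappa> * ?I g \<gamma>) / 2"
        by (simp add: field_simps)
      moreover have "w \<le> a + r + b + d" if "r = (s + t) / 2" "w \<le> a + s + b + d" "w \<le> a + t + b + d"
        for w a r s t b d :: real
        using that by (simp add: field_simps)
      ultimately show "(W2 \<nu> \<sigma>)\<^sup>2 \<le> (W2 \<nu> \<rho>)\<^sup>2 + \<kappa> * ?I (\<lambda>x. (1/2) *\<^sub>R (f x + g x)) \<gamma> + transport_cost \<gamma>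
          + 1 / Suc k * (1 + transport_cost \<gamma>)"
        using KD[OF fg(1) *] KD[OF fg(2) *] by blast
    qed
    show "g \<in> K k" if f: "\<And>j. f j \<in> K k" and g: "square_integrable \<rho> g"
      and lim: "(\<lambda>j. \<integral>x. (norm (f j x - g x))\<^sup>2 \<partial>\<rho>) \<longlonglongrightarrow> 0" for k f g
    proof (rule KI[OF g])
      fix \<sigma> \<gamma> assume *: "\<sigma> \<in> P2" "\<gamma> \<in> couplings \<rho> \<sigma>"
      have m: "(\<lambda>x. (norm (f j x - g x))\<^sup>2) \<in> borel_measurable borel" for j
      proof -
        note [measurable] = square_integrable_cong_measurable[OF p(2) si[OF f]] square_integrable_cong_measurable[OF p(2) g]
        show ?thesis by measurable
      qed
      \<comment> \<open>The shift \<open>c\<close> cancels in the difference, and the rest depends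
        on the first coordinate only, whose law is \<open>\<rho>\<close>.\<close>
      have "(\<lambda>j. \<integral>z. (norm ((f j (fst z) + c (fst z)) - (g (fst z) + c (fst z))))\<^sup>2 \<partial>\<gamma>) \<longlonglongrightarrow> 0"
        using lim by (simp add: integral_coupling(1)[OF *(2) m])
      then have "(\<lambda>j. ?I (f j) \<gamma>) \<longlonglongrightarrow> ?I g \<gamma>"
        by (rule L2_inner_tendsto[OF sc[OF si[OF f] *(2)] sc[OF g *(2)] u[OF *]])
      then have "(\<lambda>j. (W2 \<nu> \<rho>)\<^sup>2 + \<kappa> * ?I (f j) \<gamma> + transport_cost \<gamma> + 1 / Suc k * (1 + transport_cost \<gamma>))
          \<longlonglongrightarrow> (W2 \<nu> \<rho>)\<^sup>2 + \<kappa> * ?I g \<gamma> + transport_cost \<gamma> + 1 / Suc k * (1 + transport_cost \<gamma>)"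
        by (intro tendsto_add tendsto_mult tendsto_const)
      then show "(W2 \<nu> \<sigma>)\<^sup>2 \<le> (W2 \<nu> \<rho>)\<^sup>2 + \<kappa> * ?I g \<gamma> + transport_cost \<gamma> + 1 / Suc k * (1 + transport_cost \<gamma>)"
        by (rule LIMSEQ_le_const) (use KD[OF f *] in blast)
    qed
    show "\<exists>f\<in>K k. (\<integral>x. (norm (f x))\<^sup>2 \<partial>\<rho>) \<le> R" for k
    proof -
      obtain \<zeta> where "square_integrable \<rho> \<zeta>" "(\<integral>x. (norm (\<zeta> x))\<^sup>2 \<partial>\<rho>) \<le> R"
        "\<forall>\<sigma>\<in>P2. \<forall>\<gamma>\<in>couplings \<rho> \<sigma>. (W2 \<nu> \<sigma>)\<^sup>2 \<le> (W2 \<nu> \<rho>)\<^sup>2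
          + \<kappa> * ?I \<zeta> \<gamma> + transport_cost \<gamma> + 1 / Suc k * (1 + transport_cost \<gamma>)"
        using approx[of "1 / Suc k"] by auto
      then show ?thesis unfolding K_def by blast
    qed
  qed (rule that)
  show ?thesis
  proof (rule that[OF si[OF \<zeta>(1)] \<zeta>(2)])
    fix \<sigma> \<gamma> assume *: "\<sigma> \<in> P2" "\<gamma> \<in> couplings \<rho> \<sigma>"
    have one_over_Suc: "(\<lambda>k. 1 / real (Suc k)) \<longlonglongrightarrow> 0"
      using LIMSEQ_inverse_real_of_nat by (simp only: inverse_eq_divide)
    have "(\<lambda>k. (W2 \<nu> \<rho>)\<^sup>2 + \<kappa> * ?I \<zeta> \<gamma> + transport_cost \<gamma> + 1 / Suc k * (1 + transport_cost \<gamma>))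
        \<longlonglongrightarrow> (W2 \<nu> \<rho>)\<^sup>2 + \<kappa> * ?I \<zeta> \<gamma> + transport_cost \<gamma> + 0 * (1 + transport_cost \<gamma>)"
      by (intro tendsto_add tendsto_mult tendsto_const one_over_Suc)
    then have "(W2 \<nu> \<sigma>)\<^sup>2 \<le> (W2 \<nu> \<rho>)\<^sup>2 + \<kappa> * ?I \<zeta> \<gamma> + transport_cost \<gamma> + 0 * (1 + transport_cost \<gamma>)"
      by (rule LIMSEQ_le_const) (use KD[OF \<zeta>(1) *] in blast)
    then show "(W2 \<nu> \<sigma>)\<^sup>2 \<le> (W2 \<nu> \<rho>)\<^sup>2 + \<kappa> * ?I \<zeta> \<gamma> + transport_cost \<gamma>" by simp
  qed
qed

text \<open>One step in real-valued form: \<open>D\<close> stands for the set where the energies are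
  finite, \<open>J\<close> for the part treated by the backward step. The strict inequality for
  \<open>R\<close> leaves room for the approximation errors.\<close>

lemma forward_backward_step:
  fixes \<mu> \<rho> :: "'a::euclidean_space measure" and g :: "'a \<Rightarrow> 'a" and J :: "'a measure \<Rightarrow> real"
  assumes \<eta>: "0 < \<eta>" and L0: "0 \<le> L" and lip: "\<And>x y. norm (g x - g y) \<le> L * norm (x - y)"
    and lower: "\<And>x y. H x + g x \<bullet> (y - x) \<le> H y"
    and upper: "\<And>x y. H y \<le> H x + g x \<bullet> (y - x) + L * (norm (y - x))\<^sup>2"
    and Hm: "H \<in> borel_measurable borel" and Hint: "\<And>\<sigma>. \<sigma> \<in> P2 \<Longrightarrow> integrable \<sigma> H"
    and D: "D \<subseteq> P2" and \<mu>: "\<mu> \<in> D" and \<rho>: "\<rho> \<in> D"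
    and \<nu>_def: "\<nu> = distr \<mu> borel (\<lambda>x. x + \<eta> *\<^sub>R g x)"
    and minimal: "\<And>\<sigma>. \<sigma> \<in> D \<Longrightarrow> J \<rho> + (W2 \<nu> \<rho>)\<^sup>2 / (2 * \<eta>) \<le> J \<sigma> + (W2 \<nu> \<sigma>)\<^sup>2 / (2 * \<eta>)"
    and F_def: "\<And>\<sigma>. F \<sigma> = J \<sigma> - (\<integral>x. H x \<partial>\<sigma>)"
    and R: "4 * (1 + \<eta> * L)\<^sup>2 / \<eta> * (F \<mu> - F \<rho>) < R"
  obtains \<zeta> where "square_integrable \<rho> \<zeta>" "(\<integral>x. (norm (\<zeta> x))\<^sup>2 \<partial>\<rho>) \<le> R"
    "\<And>\<sigma> \<gamma>. \<sigma> \<in> D \<Longrightarrow> \<gamma> \<in> couplings \<rho> \<sigma> \<Longrightarrow>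
       (\<integral>z. \<zeta> (fst z) \<bullet> (snd z - fst z) \<partial>\<gamma>) - (L + 1 / (2 * \<eta>)) * transport_cost \<gamma> \<le> F \<sigma> - F \<rho>"
proof -
  have \<mu>P: "\<mu> \<in> P2" and \<rho>P: "\<rho> \<in> P2" using \<mu> \<rho> D by auto
  note m = P2_D[OF \<mu>P] and p = P2_D[OF \<rho>P]
  define S where "S x = x + \<eta> *\<^sub>R g x" for x
  have gc: "continuous_on UNIV g"
    by (rule lipschitz_on_continuous_on[of L]) (use lip L0 in \<open>auto simp: lipschitz_on_def dist_norm\<close>)
  then have gm [measurable]: "g \<in> borel_measurable borel" by (rule borel_measurable_continuous_onI)
  have Sc: "continuous_on UNIV S" unfolding S_def by (intro continuous_intros gc)
  then have Sm [measurable]: "S \<in> borel_measurable borel" by (rule borel_measurable_continuous_onI)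
  have g\<sigma>: "square_integrable \<sigma> g" if "\<sigma> \<in> P2" for \<sigma>
    using square_integrable_lipschitz[OF P2_D(3)[OF that] P2_D(4)[OF that] lip gm] .
  have S\<mu>: "square_integrable \<mu> S"
    unfolding S_def[abs_def] by (intro square_integrable_add square_integrable_scaleR m(3) g\<sigma>[OF \<mu>P])
  have \<nu>S: "\<nu> = distr \<mu> borel S" unfolding \<nu>_def S_def[abs_def] ..
  have \<nu>P: "\<nu> \<in> P2" unfolding \<nu>S by (rule distr_P2[OF \<mu>P Sm S\<mu>])
  \<comment> \<open>Adding the two tangent inequalities shows that the gradient is monotone, from
    which expansion of \<open>S\<close> follows.\<close>
  have mono: "0 \<le> (g x - g y) \<bullet> (x - y)" for x y
    using lower[of x y] lower[of y x] by (simp add: inner_diff_left inner_diff_right)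
  have expand: "norm (x - y) \<le> norm (S x - S y)" for x y
  proof -
    have "(norm (S x - S y))\<^sup>2 = (norm (x - y))\<^sup>2 + 2 * \<eta> * ((g x - g y) \<bullet> (x - y)) + (norm (\<eta> *\<^sub>R (g x - g y)))\<^sup>2"
      unfolding S_def by (simp add: power2_norm_eq_inner inner_simps inner_commute algebra_simps)
    moreover have "0 \<le> 2 * \<eta> * ((g x - g y) \<bullet> (x - y))" using mono \<eta> by simp
    ultimately have "(norm (x - y))\<^sup>2 \<le> (norm (S x - S y))\<^sup>2"
      using zero_le_power2[of "norm (\<eta> *\<^sub>R (g x - g y))"] by linarith
    then show ?thesis by (rule power2_le_imp_le) simp
  qed
  obtain S' where S': "S' \<in> borel_measurable borel" "\<And>x. S' (S x) = x"
    using measurable_left_inverse[OF Sc expand] by blast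
  have scaled: "w - v \<le> 2 * \<eta> * (b - a)" if "a + w / (2 * \<eta>) \<le> b + v / (2 * \<eta>)" for a b v w :: real
  proof -
    have "(w - v) / (2 * \<eta>) \<le> b - a" using that by (simp add: diff_divide_distrib)
    then show ?thesis using \<eta> by (simp add: pos_divide_le_eq mult.commute)
  qed
  let ?\<Delta> = "F \<mu> - F \<rho>" and ?w = "(W2 \<nu> \<rho>)\<^sup>2"

  \<comment> \<open>The plan induced by \<open>x \<mapsto> (S x, x)\<close> has displacement
    \<open>\<eta> *\<^sub>R g x\<close>. The bound is used when \<open>\<mu>\<close> serves as
    competitor of \<open>\<rho>\<close>.\<close>
  have forward_cost: "(W2 \<nu> \<mu>)\<^sup>2 \<le> \<eta>\<^sup>2 * (\<integral>x. (norm (g x))\<^sup>2 \<partial>\<mu>)"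
  proof -
    note [measurable_cong] = m(2)
    have T: "(\<lambda>x. (S x, x)) \<in> borel_measurable \<mu>"
      unfolding borel_prod[symmetric] by measurable
    have fstb: "fst \<in> borel_measurable (borel :: ('a \<times> 'a) measure)"
      and sndb: "snd \<in> borel_measurable (borel :: ('a \<times> 'a) measure)"
      unfolding borel_prod[symmetric] by measurable
    have "distr (distr \<mu> borel (\<lambda>x. (S x, x))) borel snd = \<mu>"
      unfolding distr_distr[OF sndb T] by (simp add: comp_def distr_id2[OF m(2)[symmetric]])
    then have "distr \<mu> borel (\<lambda>x. (S x, x)) \<in> couplings \<nu> \<mu>"
      unfolding couplings_def \<nu>S
      using prob_space.prob_space_distr[OF m(1) T] by (simp add: distr_distr[OF fstb T] comp_def)
    from W2_power2_le[OF \<nu>P \<mu>P this]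
    have "(W2 \<nu> \<mu>)\<^sup>2 \<le> transport_cost (distr \<mu> borel (\<lambda>x. (S x, x)))" .
    also have "\<dots> = (\<integral>x. (norm (S x - x))\<^sup>2 \<partial>\<mu>)"
      unfolding transport_cost_def by (subst integral_distr[OF T]) (auto simp: borel_prod[symmetric])
    also have "\<dots> = \<eta>\<^sup>2 * (\<integral>x. (norm (g x))\<^sup>2 \<partial>\<mu>)"
      by (simp add: S_def power_mult_distrib)
    finally show ?thesis .
  qed

  have approx: "\<exists>\<zeta>. square_integrable \<rho> \<zeta> \<and> (\<integral>x. (norm (\<zeta> x))\<^sup>2 \<partial>\<rho>) \<le> R \<and>
        (\<forall>\<sigma>\<in>P2. \<forall>\<gamma>\<in>couplings \<rho> \<sigma>. (W2 \<nu> \<sigma>)\<^sup>2 \<le> ?w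
          + 2 * \<eta> * (\<integral>z. (\<zeta> (fst z) + g (fst z)) \<bullet> (fst z - snd z) \<partial>\<gamma>) + transport_cost \<gamma>
          + \<epsilon> * (1 + transport_cost \<gamma>))" if \<epsilon>: "0 < \<epsilon>" for \<epsilon>
  proof -
    \<comment> \<open>\<open>A\<close> is the factor of \<open>\<delta>\<close> in the final norm
      bound after division by \<open>\<eta>\<^sup>2\<close>; \<open>gap\<close> is the slack
      available for it.\<close>
    define A where "A = 2 * (1 + \<eta> * L)\<^sup>2 / \<eta>\<^sup>2 + 2 * L\<^sup>2"
    have A: "0 \<le> A" by (simp add: A_def)
    define gap where "gap = R - 4 * (1 + \<eta> * L)\<^sup>2 / \<eta> * ?\<Delta>"
    have gap: "0 < gap" using R by (simp add: gap_def)
    \<comment> \<open>The bound 1 gives \<open>\<delta>\<^sup>2 \<le> \<delta>\<close>, the second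
      keeps the error in the distance inequality below \<open>\<epsilon>\<close>, and the third
      keeps the norm below \<open>R\<close>. The added 1 prevents division by zero.\<close>
    define \<delta> where "\<delta> = Min {1, \<epsilon> / (5 + ?w), gap / (A + 1)}"
    have w: "0 < 5 + ?w" by (rule add_pos_nonneg) auto
    have \<delta>0: "0 < \<delta>" unfolding \<delta>_def using \<epsilon> gap A w by simp
    have \<delta>1: "\<delta> \<le> 1" and "\<delta> \<le> \<epsilon> / (5 + ?w)" and "\<delta> \<le> gap / (A + 1)" unfolding \<delta>_def by auto
    then have \<delta>w: "\<delta> * (5 + ?w) \<le> \<epsilon>" and \<delta>A: "\<delta> * (A + 1) \<le> gap"
      using w A by (simp_all add: pos_le_divide_eq)
    obtain \<gamma>0 where \<gamma>0: "\<gamma>0 \<in> couplings \<nu> \<rho>" "transport_cost \<gamma>0 < ?w + \<delta>"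
      using near_optimal_coupling[OF \<nu>P \<rho>P \<delta>0] by blast
    obtain \<pi> where \<pi>: "\<pi> \<in> couplings \<mu> \<rho>"
      and swap: "distr \<pi> borel (\<lambda>z. (snd z, S (fst z))) \<in> couplings \<rho> \<nu>"
      and cost0: "transport_cost \<gamma>0 = (\<integral>z. (norm (S (fst z) - snd z))\<^sup>2 \<partial>\<pi>)"
      using pull_back_coupling[OF m(2) Sm S' \<gamma>0(1)[unfolded \<nu>S]] unfolding \<nu>S by blast
    note c\<pi> = couplings_D[OF \<pi>]
    have [measurable_cong]: "sets \<pi> = sets (borel \<Otimes>\<^sub>M borel)" using c\<pi>(2) by (simp only: borel_prod)
    let ?\<gamma>' = "distr \<pi> borel (\<lambda>z. (snd z, S (fst z)))"
    let ?d = "\<lambda>z. fst z - snd z :: 'a"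
    define D2 where "D2 = transport_cost \<pi>"
    have d: "square_integrable \<pi> ?d" by (rule square_integrable_displacement[OF \<mu>P \<rho>P \<pi>])
    have g\<pi>: "square_integrable \<pi> (\<lambda>z. g (fst z))" by (rule square_integrable_coupling(1)[OF \<pi> g\<sigma>[OF \<mu>P]])
    have gd: "integrable \<pi> (\<lambda>z. g (fst z) \<bullet> ?d z)" by (rule square_integrable_inner[OF g\<pi> d])
    \<comment> \<open>The cost is expanded around \<open>x - y\<close>. Near-optimality, minimality
      against \<open>\<mu>\<close> and the forward cost cancel the square of \<open>g\<close>; the
      tangent inequality for \<open>H\<close> turns the cross term into a difference of potentials,
      so that \<open>J\<close> becomes \<open>F\<close>.\<close>
    have D2: "D2 \<le> 2 * \<eta> * ?\<Delta> + \<delta>"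
    proof -
      have "transport_cost \<gamma>0 = (\<integral>z. \<eta>\<^sup>2 * (norm (g (fst z)))\<^sup>2 + 2 * \<eta> * (g (fst z) \<bullet> ?d z) + (norm (?d z))\<^sup>2 \<partial>\<pi>)"
        unfolding cost0
      proof (rule Bochner_Integration.integral_cong[OF refl])
        fix z
        have "S (fst z) - snd z = ?d z - (- \<eta>) *\<^sub>R g (fst z)" by (simp add: S_def)
        then show "(norm (S (fst z) - snd z))\<^sup>2
            = \<eta>\<^sup>2 * (norm (g (fst z)))\<^sup>2 + 2 * \<eta> * (g (fst z) \<bullet> ?d z) + (norm (?d z))\<^sup>2"
          by (simp only: norm_diff_sq) (simp add: power_mult_distrib inner_commute)
      qed
      also have "\<dots> = \<eta>\<^sup>2 * (\<integral>z. (norm (g (fst z)))\<^sup>2 \<partial>\<pi>) + 2 * \<eta> * (\<integral>z. g (fst z) \<bullet> ?d z \<partial>\<pi>) + D2"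
        using square_integrableD[OF g\<pi>] square_integrableD[OF d] gd by (simp add: D2_def transport_cost_def)
      also have "(\<integral>z. (norm (g (fst z)))\<^sup>2 \<partial>\<pi>) = (\<integral>x. (norm (g x))\<^sup>2 \<partial>\<mu>)"
        by (rule integral_coupling(1)[OF \<pi>]) measurable
      finally have c0: "transport_cost \<gamma>0 = \<eta>\<^sup>2 * (\<integral>x. (norm (g x))\<^sup>2 \<partial>\<mu>) + 2 * \<eta> * (\<integral>z. g (fst z) \<bullet> ?d z \<partial>\<pi>) + D2" .
      have J: "?w - (W2 \<nu> \<mu>)\<^sup>2 \<le> 2 * \<eta> * (J \<mu> - J \<rho>)"
        by (rule scaled[OF minimal[OF \<mu>]])
      have iH: "integrable \<pi> (\<lambda>z. H (fst z))" "integrable \<pi> (\<lambda>z. H (snd z))"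
        by (rule integral_coupling(3,4)[OF \<pi> Hm Hint] \<mu>P \<rho>P)+
      have "- (\<integral>z. g (fst z) \<bullet> ?d z \<partial>\<pi>) = (\<integral>z. - (g (fst z) \<bullet> ?d z) \<partial>\<pi>)" by simp
      also have "\<dots> \<le> (\<integral>z. H (snd z) - H (fst z) \<partial>\<pi>)"
      proof (intro integral_mono)
        show "- (g (fst z) \<bullet> ?d z) \<le> H (snd z) - H (fst z)" for z
          using lower[of "fst z" "snd z"] by (simp add: inner_diff_right)
      qed (use gd iH in auto)
      also have "\<dots> = (\<integral>x. H x \<partial>\<rho>) - (\<integral>x. H x \<partial>\<mu>)"
        using iH by (simp add: integral_coupling(1,2)[OF \<pi> Hm])
      finally have "2 * \<eta> * (J \<mu> - J \<rho> - (\<integral>z. g (fst z) \<bullet> ?d z \<partial>\<pi>)) \<le> 2 * \<eta> * ?\<Delta>"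
        unfolding F_def using \<eta> by (intro mult_left_mono) auto
      then show ?thesis
        using J c0 \<gamma>0(2) forward_cost by (simp add: algebra_simps)
    qed
    obtain \<xi> where \<xi>: "square_integrable \<rho> \<xi>"
      and \<xi>W: "\<And>\<sigma> \<gamma>. \<sigma> \<in> P2 \<Longrightarrow> \<gamma> \<in> couplings \<rho> \<sigma> \<Longrightarrow> (W2 \<nu> \<sigma>)\<^sup>2 \<le> transport_cost ?\<gamma>'
       + 2 * (\<integral>z. \<xi> (fst z) \<bullet> (fst z - snd z) \<partial>\<gamma>) + transport_cost \<gamma>
       + \<delta> * (2 + \<delta> + transport_cost ?\<gamma>' + transport_cost \<gamma>)"
      and \<xi>n: "\<And>h L. 0 \<le> L \<Longrightarrow> h \<in> borel_measurable borel \<Longrightarrow> square_integrable \<rho> h \<Longrightarrow>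
       (\<And>x y. norm (h x - h y) \<le> L * norm (x - y)) \<Longrightarrow>
       (\<integral>x. (norm (\<xi> x - h x))\<^sup>2 \<partial>\<rho>)
         \<le> 2 * (\<integral>z. (norm (snd z - fst z - h (fst z)))\<^sup>2 \<partial>?\<gamma>') + 2 * (L * \<delta>)\<^sup>2"
      using approximate_barycenter[OF \<rho>P \<nu>P swap \<delta>0] by blast
    have T: "(\<lambda>z. (snd z, S (fst z))) \<in> borel_measurable \<pi>" unfolding borel_prod[symmetric] by measurable
    have cost': "transport_cost ?\<gamma>' = transport_cost \<gamma>0"
    proof -
      have "transport_cost ?\<gamma>' = (\<integral>z. (norm (snd z - S (fst z)))\<^sup>2 \<partial>\<pi>)"
        unfolding transport_cost_def by (subst integral_distr[OF T]) (auto simp: borel_prod[symmetric])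
      then show ?thesis unfolding cost0 by (simp add: norm_minus_commute)
    qed
    let ?\<zeta> = "\<lambda>x. (1 / \<eta>) *\<^sub>R \<xi> x - g x"
    have si: "square_integrable \<rho> ?\<zeta>"
      by (intro square_integrable_diff square_integrable_scaleR \<xi> g\<sigma>[OF \<rho>P])
    moreover have "(\<integral>x. (norm (?\<zeta> x))\<^sup>2 \<partial>\<rho>) \<le> R"
    proof -
      \<comment> \<open>Comparing \<open>\<xi>\<close> with \<open>\<eta> *\<^sub>R g\<close> is the
        right choice because \<open>S x - y - \<eta> *\<^sub>R g y\<close> equals
        \<open>(x - y) + \<eta> *\<^sub>R (g x - g y)\<close>, whose norm is at most
        \<open>1 + \<eta> * L\<close> times that of \<open>x - y\<close>.\<close>
      have "(\<integral>x. (norm (\<xi> x - \<eta> *\<^sub>R g x))\<^sup>2 \<partial>\<rho>)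
          \<le> 2 * (\<integral>z. (norm (snd z - fst z - \<eta> *\<^sub>R g (fst z)))\<^sup>2 \<partial>?\<gamma>') + 2 * (\<eta> * L * \<delta>)\<^sup>2"
      proof (rule \<xi>n)
        show "norm (\<eta> *\<^sub>R g x - \<eta> *\<^sub>R g y) \<le> \<eta> * L * norm (x - y)" for x y
          using lip[of x y] \<eta> by (simp flip: scaleR_diff_right)
      qed (use \<eta> L0 g\<sigma>[OF \<rho>P] in \<open>auto intro: square_integrable_scaleR\<close>)
      also have "(\<integral>z. (norm (snd z - fst z - \<eta> *\<^sub>R g (fst z)))\<^sup>2 \<partial>?\<gamma>')
          = (\<integral>z. (norm (S (fst z) - snd z - \<eta> *\<^sub>R g (snd z)))\<^sup>2 \<partial>\<pi>)"
        by (subst integral_distr[OF T]) (auto simp: borel_prod[symmetric])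
      also have "\<dots> \<le> (\<integral>z. (1 + \<eta> * L)\<^sup>2 * (norm (?d z))\<^sup>2 \<partial>\<pi>)"
      proof (rule integral_mono_AE')
        show "integrable \<pi> (\<lambda>z. (1 + \<eta> * L)\<^sup>2 * (norm (?d z))\<^sup>2)"
          by (rule integrable_mult_right[OF square_integrableD[OF d]])
        have "(norm (S x - y - \<eta> *\<^sub>R g y))\<^sup>2 \<le> (1 + \<eta> * L)\<^sup>2 * (norm (x - y))\<^sup>2" for x y
        proof -
          have "norm (S x - y - \<eta> *\<^sub>R g y) = norm ((x - y) + \<eta> *\<^sub>R (g x - g y))"
            by (simp add: S_def algebra_simps)
          also have "\<dots> \<le> norm (x - y) + \<eta> * norm (g x - g y)"
            using norm_triangle_ineq[of "x - y" "\<eta> *\<^sub>R (g x - g y)"] \<eta> by simp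
          also have "\<dots> \<le> norm (x - y) + \<eta> * (L * norm (x - y))"
            using lip \<eta> by (intro add_left_mono mult_left_mono) auto
          also have "\<dots> = (1 + \<eta> * L) * norm (x - y)" by (simp add: algebra_simps)
          finally show ?thesis unfolding power_mult_distrib[symmetric] by (rule power_mono) simp
        qed
        then show "AE z in \<pi>. (norm (S (fst z) - snd z - \<eta> *\<^sub>R g (snd z)))\<^sup>2 \<le> (1 + \<eta> * L)\<^sup>2 * (norm (?d z))\<^sup>2"
          by simp
      qed simp
      also have "\<dots> = (1 + \<eta> * L)\<^sup>2 * D2" by (simp add: D2_def transport_cost_def)
      finally have "(\<integral>x. (norm (\<xi> x - \<eta> *\<^sub>R g x))\<^sup>2 \<partial>\<rho>) \<le> 2 * ((1 + \<eta> * L)\<^sup>2 * D2) + 2 * (\<eta> * L * \<delta>)\<^sup>2"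
        by simp
      also have "(\<integral>x. (norm (\<xi> x - \<eta> *\<^sub>R g x))\<^sup>2 \<partial>\<rho>) = (\<integral>x. \<eta>\<^sup>2 * (norm (?\<zeta> x))\<^sup>2 \<partial>\<rho>)"
      proof (rule Bochner_Integration.integral_cong[OF refl])
        fix x
        have "\<xi> x - \<eta> *\<^sub>R g x = \<eta> *\<^sub>R ?\<zeta> x" using \<eta> by (simp add: scaleR_diff_right)
        then show "(norm (\<xi> x - \<eta> *\<^sub>R g x))\<^sup>2 = \<eta>\<^sup>2 * (norm (?\<zeta> x))\<^sup>2" by (simp add: power_mult_distrib)
      qed
      finally have "\<eta>\<^sup>2 * (\<integral>x. (norm (?\<zeta> x))\<^sup>2 \<partial>\<rho>) \<le> 2 * ((1 + \<eta> * L)\<^sup>2 * D2) + 2 * (\<eta> * L * \<delta>)\<^sup>2" by simp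
      also have "\<dots> \<le> 2 * ((1 + \<eta> * L)\<^sup>2 * (2 * \<eta> * ?\<Delta> + \<delta>)) + 2 * ((\<eta> * L)\<^sup>2 * \<delta>)"
      proof -
        have "\<delta>\<^sup>2 \<le> \<delta>" using \<delta>0 \<delta>1 by (simp add: power2_eq_square mult_left_le)
        then show ?thesis
          unfolding power_mult_distrib[of "\<eta> * L" \<delta>] using D2
          by (intro add_mono mult_left_mono) auto
      qed
      also have "\<dots> = \<eta>\<^sup>2 * (4 * (1 + \<eta> * L)\<^sup>2 / \<eta> * ?\<Delta> + \<delta> * A)"
        using \<eta> by (simp add: A_def field_simps power2_eq_square)
      finally have "(\<integral>x. (norm (?\<zeta> x))\<^sup>2 \<partial>\<rho>) \<le> 4 * (1 + \<eta> * L)\<^sup>2 / \<eta> * ?\<Delta> + \<delta> * A"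
        using \<eta> by (simp add: mult_le_cancel_left_pos)
      also have "\<dots> \<le> R" using \<delta>A \<delta>0 unfolding gap_def distrib_left mult_1_right by linarith
      finally show ?thesis .
    qed
    moreover have "(W2 \<nu> \<sigma>)\<^sup>2 \<le> ?w
          + 2 * \<eta> * (\<integral>z. (?\<zeta> (fst z) + g (fst z)) \<bullet> (fst z - snd z) \<partial>\<gamma>) + transport_cost \<gamma>
          + \<epsilon> * (1 + transport_cost \<gamma>)" if "\<sigma> \<in> P2" "\<gamma> \<in> couplings \<rho> \<sigma>" for \<sigma> \<gamma>
    proof -
      let ?c = "transport_cost \<gamma>"
      have c: "0 \<le> ?c" by (rule transport_cost_nonneg)
      have "2 * \<eta> * (\<integral>z. (?\<zeta> (fst z) + g (fst z)) \<bullet> (fst z - snd z) \<partial>\<gamma>)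
          = 2 * (\<integral>z. \<xi> (fst z) \<bullet> (fst z - snd z) \<partial>\<gamma>)"
        using \<eta> by simp
      \<comment> \<open>The first \<open>\<delta>\<close> pays for replacing the cost of
        \<open>\<gamma>0\<close> by the squared distance, the second term is the gluing error. The
        constant 5 absorbs 3 and two occurrences of \<open>\<delta> \<le> 1\<close>.\<close>
      moreover have "\<delta> + \<delta> * (2 + \<delta> + transport_cost \<gamma>0 + ?c) \<le> \<epsilon> * (1 + ?c)"
      proof -
        have "\<delta> + \<delta> * (2 + \<delta> + transport_cost \<gamma>0 + ?c) = \<delta> * (3 + \<delta> + transport_cost \<gamma>0 + ?c)"
          by (simp add: algebra_simps)
        also have "\<dots> \<le> \<delta> * ((5 + ?w) * (1 + ?c))"
        proof (rule mult_left_mono)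
          have "0 \<le> (4 + ?w) * ?c" using c by simp
          moreover have "(5 + ?w) * (1 + ?c) = 5 + ?w + ?c + (4 + ?w) * ?c" by (simp add: algebra_simps)
          ultimately show "3 + \<delta> + transport_cost \<gamma>0 + ?c \<le> (5 + ?w) * (1 + ?c)"
            using \<gamma>0(2) \<delta>1 by linarith
        qed (use \<delta>0 in simp)
        also have "\<dots> = \<delta> * (5 + ?w) * (1 + ?c)" by simp
        also have "\<dots> \<le> \<epsilon> * (1 + ?c)" using \<delta>w c by (intro mult_right_mono) auto
        finally show ?thesis .
      qed
      ultimately show ?thesis using \<xi>W[OF that] \<gamma>0(2) unfolding cost' by linarith
    qed
    ultimately show ?thesis by (intro exI[of _ ?\<zeta>]) blast
  qed

  obtain \<zeta> where \<zeta>: "square_integrable \<rho> \<zeta>" "(\<integral>x. (norm (\<zeta> x))\<^sup>2 \<partial>\<rho>) \<le> R"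
    and \<zeta>W: "\<And>\<sigma> \<gamma>. \<sigma> \<in> P2 \<Longrightarrow> \<gamma> \<in> couplings \<rho> \<sigma> \<Longrightarrow> (W2 \<nu> \<sigma>)\<^sup>2 \<le> ?w
       + 2 * \<eta> * (\<integral>z. (\<zeta> (fst z) + g (fst z)) \<bullet> (fst z - snd z) \<partial>\<gamma>) + transport_cost \<gamma>"
    using W2_subgradient[OF \<nu>P \<rho>P g\<sigma>[OF \<rho>P] approx] by blast
  show ?thesis
  proof (rule that[OF \<zeta>])
    fix \<sigma> \<gamma> assume \<sigma>: "\<sigma> \<in> D" and \<gamma>: "\<gamma> \<in> couplings \<rho> \<sigma>"
    have \<sigma>P: "\<sigma> \<in> P2" using \<sigma> D by auto
    let ?d = "\<lambda>z. fst z - snd z :: 'a"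
    have d: "square_integrable \<gamma> ?d" by (rule square_integrable_displacement[OF \<rho>P \<sigma>P \<gamma>])
    have i: "integrable \<gamma> (\<lambda>z. \<zeta> (fst z) \<bullet> ?d z)" "integrable \<gamma> (\<lambda>z. g (fst z) \<bullet> ?d z)"
      by (intro square_integrable_inner d square_integrable_coupling(1)[OF \<gamma>] \<zeta>(1) g\<sigma>[OF \<rho>P])+
    have "(\<integral>z. (\<zeta> (fst z) + g (fst z)) \<bullet> ?d z \<partial>\<gamma>) = (\<integral>z. \<zeta> (fst z) \<bullet> ?d z + g (fst z) \<bullet> ?d z \<partial>\<gamma>)"
      by (simp only: inner_add_left)
    also have "\<dots> = (\<integral>z. \<zeta> (fst z) \<bullet> ?d z \<partial>\<gamma>) + (\<integral>z. g (fst z) \<bullet> ?d z \<partial>\<gamma>)"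
      by (rule Bochner_Integration.integral_add[OF i])
    finally have split: "(\<integral>z. (\<zeta> (fst z) + g (fst z)) \<bullet> ?d z \<partial>\<gamma>)
      = (\<integral>z. \<zeta> (fst z) \<bullet> ?d z \<partial>\<gamma>) + (\<integral>z. g (fst z) \<bullet> ?d z \<partial>\<gamma>)" .
    have "?w - (W2 \<nu> \<sigma>)\<^sup>2 \<le> 2 * \<eta> * (J \<sigma> - J \<rho>)"
      by (rule scaled[OF minimal[OF \<sigma>]])
    then have "2 * \<eta> * (J \<rho> - J \<sigma>) \<le> 2 * \<eta> * ((\<integral>z. \<zeta> (fst z) \<bullet> ?d z \<partial>\<gamma>) + (\<integral>z. g (fst z) \<bullet> ?d z \<partial>\<gamma>)
        + transport_cost \<gamma> / (2 * \<eta>))"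
      using \<zeta>W[OF \<sigma>P \<gamma>] \<eta> unfolding split by (simp add: algebra_simps)
    then have J: "J \<rho> - J \<sigma> \<le> (\<integral>z. \<zeta> (fst z) \<bullet> ?d z \<partial>\<gamma>) + (\<integral>z. g (fst z) \<bullet> ?d z \<partial>\<gamma>)
        + transport_cost \<gamma> / (2 * \<eta>)"
      using \<eta> by (simp only: mult_le_cancel_left_pos)
    have iH: "integrable \<gamma> (\<lambda>z. H (fst z))" "integrable \<gamma> (\<lambda>z. H (snd z))"
      by (rule integral_coupling(3,4)[OF \<gamma> Hm Hint] \<sigma>P \<rho>P)+
    \<comment> \<open>The quadratic upper bound for \<open>H\<close> expanded at the second
      coordinate would involve the gradient at \<open>\<sigma>\<close>; expanded at the first, its
      linear term cancels the \<open>g\<close>-term left by the JKO inequality.\<close>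
    have "(\<integral>x. H x \<partial>\<sigma>) - (\<integral>x. H x \<partial>\<rho>) = (\<integral>z. H (snd z) - H (fst z) \<partial>\<gamma>)"
      using iH by (simp add: integral_coupling(1,2)[OF \<gamma> Hm])
    also have "\<dots> \<le> (\<integral>z. L * (norm (?d z))\<^sup>2 - g (fst z) \<bullet> ?d z \<partial>\<gamma>)"
    proof (rule integral_mono)
      show "integrable \<gamma> (\<lambda>z. L * (norm (?d z))\<^sup>2 - g (fst z) \<bullet> ?d z)"
        by (intro Bochner_Integration.integrable_diff integrable_mult_right square_integrableD[OF d] i)
      show "H (snd z) - H (fst z) \<le> L * (norm (?d z))\<^sup>2 - g (fst z) \<bullet> ?d z" for z
        using upper[of "snd z" "fst z"] by (simp add: inner_diff_right norm_minus_commute)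
    qed (use iH in auto)
    also have "\<dots> = L * transport_cost \<gamma> - (\<integral>z. g (fst z) \<bullet> ?d z \<partial>\<gamma>)"
      using square_integrableD[OF d] i by (simp add: transport_cost_def)
    finally have "F \<rho> - F \<sigma> \<le> (\<integral>z. \<zeta> (fst z) \<bullet> ?d z \<partial>\<gamma>) + (L + 1 / (2 * \<eta>)) * transport_cost \<gamma>"
      using J unfolding F_def by (simp add: algebra_simps)
    moreover have "(\<integral>z. \<zeta> (fst z) \<bullet> (snd z - fst z) \<partial>\<gamma>) = - (\<integral>z. \<zeta> (fst z) \<bullet> ?d z \<partial>\<gamma>)"
      unfolding integral_minus[symmetric] by (rule Bochner_Integration.integral_cong) (simp_all add: inner_diff_right)
    ultimately show "(\<integral>z. \<zeta> (fst z) \<bullet> (snd z - fst z) \<partial>\<gamma>) - (L + 1 / (2 * \<eta>)) * transport_cost \<gamma> \<le> F \<sigma> - F \<rho>"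
      by linarith
  qed
qed

section \<open>Convergence rate\<close>

text \<open>On an optimal plan the transport cost is the squared distance, so the quadratic error
  becomes the remainder \<open>- c * s\<^sup>2\<close>, which is \<open>o(s)\<close>. Competitors of
  infinite energy satisfy the inequality trivially.\<close>

lemma dist_zero_subdiff_le:
  fixes F :: "'a::euclidean_space measure \<Rightarrow> ereal"
  assumes \<rho>: "\<rho> \<in> P2" and F\<rho>: "F \<rho> = ereal (f \<rho>)" and \<zeta>: "square_integrable \<rho> \<zeta>"
    and R: "(\<integral>x. (norm (\<zeta> x))\<^sup>2 \<partial>\<rho>) \<le> R"
    and cases: "\<And>\<sigma>. \<sigma> \<in> P2 \<Longrightarrow> F \<sigma> = \<infinity> \<or> F \<sigma> = ereal (f \<sigma>) \<and>
      (\<forall>\<gamma>\<in>couplings \<rho> \<sigma>. (\<integral>z. \<zeta> (fst z) \<bullet> (snd z - fst z) \<partial>\<gamma>) - c * transport_cost \<gamma> \<le> f \<sigma> - f \<rho>)"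
  shows "dist_zero_subdiff F \<rho> \<le> ereal (sqrt R)"
proof -
  have "\<zeta> \<in> frechet_subdiff F \<rho>"
    unfolding frechet_subdiff_def
  proof (intro CollectI conjI exI[of _ "\<lambda>s. - c * s\<^sup>2"] ballI)
    show "\<rho> \<in> eff_dom F" using \<rho> F\<rho> by (simp add: eff_dom_def)
    show "\<zeta> \<in> L2_maps \<rho>" using \<zeta> L2_maps_iff[OF P2_D(2)[OF \<rho>]] by simp
    have "((\<lambda>s. - c * s) \<longlongrightarrow> - c * 0) (at_right 0)" by (intro tendsto_intros)
    moreover have "(\<lambda>s. - c * s\<^sup>2 / s) = (\<lambda>s. - c * s)"
      by (simp add: fun_eq_iff power2_eq_square)
    ultimately show "((\<lambda>s. - c * s\<^sup>2 / s) \<longlongrightarrow> 0) (at_right 0)"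
      by (simp only: mult_zero_right)
    fix \<sigma> :: "'a measure" assume \<sigma>: "\<sigma> \<in> P2"
    let ?P = "\<lambda>\<gamma>. ereal (\<integral>z. \<zeta> (fst z) \<bullet> (snd z - fst z) \<partial>\<gamma>)"
    let ?r = "- c * (W2 \<rho> \<sigma>)\<^sup>2"
    from cases[OF \<sigma>] show "(SUP \<gamma>\<in>optimal_plans \<rho> \<sigma>. ?P \<gamma>) + ereal ?r \<le> F \<sigma> - F \<rho>"
    proof (elim disjE conjE)
      assume "F \<sigma> = \<infinity>"
      then show ?thesis using F\<rho> by simp
    next
      assume F\<sigma>: "F \<sigma> = ereal (f \<sigma>)" and
        *: "\<forall>\<gamma>\<in>couplings \<rho> \<sigma>. (\<integral>z. \<zeta> (fst z) \<bullet> (snd z - fst z) \<partial>\<gamma>) - c * transport_cost \<gamma> \<le> f \<sigma> - f \<rho>"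
      \<comment> \<open>Bounding plan by plan also covers an empty set of optimal plans, where the
        supremum is minus infinity.\<close>
      have "(SUP \<gamma>\<in>optimal_plans \<rho> \<sigma>. ?P \<gamma>) \<le> ereal (f \<sigma> - f \<rho> - ?r)"
      proof (rule SUP_least)
        fix \<gamma> assume "\<gamma> \<in> optimal_plans \<rho> \<sigma>"
        then show "?P \<gamma> \<le> ereal (f \<sigma> - f \<rho> - ?r)"
          using * optimal_plans_cost[OF \<rho> \<sigma>] by fastforce
      qed
      then have "(SUP \<gamma>\<in>optimal_plans \<rho> \<sigma>. ?P \<gamma>) + ereal ?r \<le> ereal (f \<sigma> - f \<rho> - ?r) + ereal ?r"
        by (rule add_right_mono)
      then show ?thesis using F\<rho> F\<sigma> by simp
    qed
  qed
  then have "dist_zero_subdiff F \<rho> \<le> ereal (L2_norm \<rho> \<zeta>)"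
    unfolding dist_zero_subdiff_def by (rule INF_lower)
  also have "\<dots> \<le> ereal (sqrt R)"
    unfolding L2_norm_def using R by simp
  finally show ?thesis .
qed

text \<open>If each of the first \<open>N\<close> decrements exceeded the average, their telescoping
  sum would push \<open>a N\<close> below \<open>m\<close>.\<close>

lemma small_decrement:
  fixes a :: "nat \<Rightarrow> real"
  assumes "\<And>n. m \<le> a n" "0 < N"
  obtains i where "i < N" "a i - a (Suc i) \<le> (a 0 - m) / real N"
proof (rule ccontr)
  assume "\<not> thesis"
  then have "\<And>i. i < N \<Longrightarrow> (a 0 - m) / real N < a i - a (Suc i)" using that not_less by blast
  then have "(\<Sum>i<N. (a 0 - m) / real N) < (\<Sum>i<N. a i - a (Suc i))"
    using assms(2) by (intro sum_strict_mono) auto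
  then have "a 0 - m < a 0 - a N"
    using assms(2) by (simp add: sum_lessThan_telescope')
  then show False using assms(1)[of N] by simp
qed

theorem theorem3:
  fixes G H :: "'a::euclidean_space \<Rightarrow> real"
    and \<H> \<F> :: "'a measure \<Rightarrow> ereal"
    and \<eta>\<^sub>0 \<eta> :: real
    and \<mu> \<nu> :: "nat \<Rightarrow> 'a measure"
  assumes F_def: "\<F> = (\<lambda>\<rho>. \<H> \<rho> + potential_energy G \<rho> - potential_energy H \<rho>)"
    and F_bdd_below: "bounded_below \<F>"
    and G_convex: "convex_on UNIV G" and G_growth: "quadratic_growth G"
    and H_convex: "convex_on UNIV H" and H_growth: "quadratic_growth H"
    and ent_values: "never_minus_infinity \<H>"
    and ent_proper: "proper \<H>"
    and ent_lsc: "W2_lsc \<H>"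
    and ent_convex: "convex_along_generalized_geodesics \<H>"
    and ent_dom: "eff_dom \<H> \<subseteq> P2_abs"
    and eta0_pos: "\<eta>\<^sub>0 > 0"
    and JKO_nonempty: "\<And>\<tau> \<rho>. \<tau> \<in> {0<..<\<eta>\<^sub>0} \<Longrightarrow> \<rho> \<in> P2 \<Longrightarrow>
          JKO \<tau> (\<lambda>\<sigma>. potential_energy G \<sigma> + \<H> \<sigma>) \<rho> \<noteq> {}"
    and H_C2: "C2 H"
    and H_hessian_bdd: "bounded (range (hessian H))"
    and eta: "0 < \<eta>" "\<eta> < \<eta>\<^sub>0"
    and init: "\<mu> 0 \<in> P2_abs"
    and forward: "\<And>n. \<nu> (Suc n) = distr (\<mu> n) borel (\<lambda>x. x + \<eta> *\<^sub>R gradient H x)"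
    and backward: "\<And>n. \<mu> (Suc n) \<in> JKO \<eta> (\<lambda>\<sigma>. potential_energy G \<sigma> + \<H> \<sigma>) (\<nu> (Suc n))"
  shows "\<exists>C::real. \<forall>\<^sub>F N in sequentially.
           (MIN n\<in>{1..N}. dist_zero_subdiff \<F> (\<mu> n)) \<le> ereal (C * real N powr (-1/2))"
proof -
  obtain L where L0: "0 \<le> L" and lip: "\<And>x y. norm (gradient H x - gradient H y) \<le> L * norm (x - y)"
    using gradient_lipschitz[OF H_C2 H_hessian_bdd] by blast
  have grad: "GDERIV H x :> gradient H x" for x
    using H_C2 by (intro GDERIV_gradient) (simp add: C2_def)
  note lower = convex_gradient_lower_bound[OF H_convex grad]
    and upper = lipschitz_gradient_upper_bound[OF grad lip L0]
  have H_cont: "continuous_on UNIV H"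
    using H_convex by (intro convex_on_continuous) auto
  note Hm = borel_measurable_continuous_onI[OF H_cont]
    and Hint = potential_integrable[OF H_growth H_cont]

  \<comment> \<open>\<open>J\<close> and \<open>f\<close> are real versions of the backward energy
    and of \<open>\<F>\<close>; they agree with the extended-real functionals on \<open>D\<close>
    and are meaningful only there.\<close>
  define D where "D = eff_dom \<H>"
  define J where "J \<sigma> = real_of_ereal (\<H> \<sigma>) + (\<integral>x. G x \<partial>\<sigma>)" for \<sigma>
  define f where "f \<sigma> = J \<sigma> - (\<integral>x. H x \<partial>\<sigma>)" for \<sigma>
  have DP: "D \<subseteq> P2" by (auto simp: D_def eff_dom_def)
  have HD: "\<H> \<sigma> = ereal (real_of_ereal (\<H> \<sigma>))" if "\<sigma> \<in> D" for \<sigma>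
    using that ent_values by (auto simp: D_def eff_dom_def never_minus_infinity_def ereal_real)
  have HnD: "\<H> \<sigma> = \<infinity>" if "\<sigma> \<in> P2" "\<sigma> \<notin> D" for \<sigma>
    using that by (auto simp: D_def eff_dom_def)
  have FD: "\<F> \<sigma> = ereal (f \<sigma>)" if "\<sigma> \<in> D" for \<sigma>
    unfolding F_def by (subst HD[OF that]) (simp add: f_def J_def potential_energy_def)
  have FnD: "\<F> \<sigma> = \<infinity>" if "\<sigma> \<in> P2" "\<sigma> \<notin> D" for \<sigma>
    using HnD[OF that] by (simp add: F_def potential_energy_def)
  let ?\<phi> = "\<lambda>n \<sigma>. potential_energy G \<sigma> + \<H> \<sigma> + ereal (1 / (2 * \<eta>) * (W2 (\<nu> (Suc n)) \<sigma>)\<^sup>2)"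
  have \<phi>D: "?\<phi> n \<sigma> = ereal (J \<sigma> + (W2 (\<nu> (Suc n)) \<sigma>)\<^sup>2 / (2 * \<eta>))" if "\<sigma> \<in> D" for n \<sigma>
    by (subst HD[OF that]) (simp add: J_def potential_energy_def)
  have JKO: "\<mu> (Suc n) \<in> P2" "\<And>\<sigma>. \<sigma> \<in> P2 \<Longrightarrow> ?\<phi> n (\<mu> (Suc n)) \<le> ?\<phi> n \<sigma>" for n
    using backward[of n] by (auto simp: JKO_def is_arg_min_def not_less)
  \<comment> \<open>Properness supplies a competitor with finite JKO value, so a minimizer cannot
    have infinite energy.\<close>
  have \<mu>D: "\<mu> (Suc n) \<in> D" for n
  proof (rule ccontr)
    assume "\<mu> (Suc n) \<notin> D"
    then have "?\<phi> n (\<mu> (Suc n)) = \<infinity>" using HnD JKO(1) by (simp add: potential_energy_def)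
    moreover obtain \<sigma> where "\<sigma> \<in> D" using ent_proper by (auto simp: proper_def D_def)
    ultimately show False using JKO(2)[of \<sigma> n] \<phi>D[of \<sigma> n] DP by auto
  qed
  have minimal: "J (\<mu> (Suc n)) + (W2 (\<nu> (Suc n)) (\<mu> (Suc n)))\<^sup>2 / (2 * \<eta>)
      \<le> J \<sigma> + (W2 (\<nu> (Suc n)) \<sigma>)\<^sup>2 / (2 * \<eta>)" if "\<sigma> \<in> D" for n \<sigma>
    using JKO(2)[of \<sigma> n] that DP \<phi>D[OF that, of n] \<phi>D[OF \<mu>D, of n n] by auto

  define C where "C = 4 * (1 + \<eta> * L)\<^sup>2 / \<eta>"
  have C: "0 \<le> C" using eta by (simp add: C_def)
  \<comment> \<open>Indices start at \<open>Suc (Suc n)\<close>, since \<open>\<F>\<close> may be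
    infinite at \<open>\<mu> 0\<close> and the decrement must be taken between two iterates in
    \<open>D\<close>.\<close>
  have step: "dist_zero_subdiff \<F> (\<mu> (Suc (Suc n))) \<le> ereal (sqrt R)"
    if decrement: "C * (f (\<mu> (Suc n)) - f (\<mu> (Suc (Suc n)))) < R" for n R
  proof -
    obtain \<zeta> where \<zeta>: "square_integrable (\<mu> (Suc (Suc n))) \<zeta>"
      "(\<integral>x. (norm (\<zeta> x))\<^sup>2 \<partial>\<mu> (Suc (Suc n))) \<le> R"
      "\<And>\<sigma> \<gamma>. \<sigma> \<in> D \<Longrightarrow> \<gamma> \<in> couplings (\<mu> (Suc (Suc n))) \<sigma> \<Longrightarrow>
       (\<integral>z. \<zeta> (fst z) \<bullet> (snd z - fst z) \<partial>\<gamma>) - (L + 1 / (2 * \<eta>)) * transport_cost \<gamma>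
         \<le> f \<sigma> - f (\<mu> (Suc (Suc n)))"
      using forward_backward_step[where g = "gradient H" and H = H and J = J and F = f and D = D
          and \<nu> = "\<nu> (Suc (Suc n))" and \<mu> = "\<mu> (Suc n)" and \<rho> = "\<mu> (Suc (Suc n))" and R = R,
          OF eta(1) L0 lip lower upper Hm Hint DP \<mu>D \<mu>D forward minimal f_def
          decrement[unfolded C_def]] by blast
    show ?thesis
    proof (rule dist_zero_subdiff_le[where F = \<F> and f = f and \<rho> = "\<mu> (Suc (Suc n))",
          OF JKO(1) FD[OF \<mu>D] \<zeta>(1,2)])
      fix \<sigma> :: "'a measure" assume "\<sigma> \<in> P2"
      then show "\<F> \<sigma> = \<infinity> \<or> \<F> \<sigma> = ereal (f \<sigma>) \<and> (\<forall>\<gamma>\<in>couplings (\<mu> (Suc (Suc n))) \<sigma>.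
          (\<integral>z. \<zeta> (fst z) \<bullet> (snd z - fst z) \<partial>\<gamma>) - (L + 1 / (2 * \<eta>)) * transport_cost \<gamma>
            \<le> f \<sigma> - f (\<mu> (Suc (Suc n))))"
        using FD FnD \<zeta>(3) by blast
    qed
  qed

  \<comment> \<open>Telescoping of the energy decrements\<close>
  obtain m where m: "\<And>\<sigma>. \<sigma> \<in> P2 \<Longrightarrow> ereal m \<le> \<F> \<sigma>"
    using F_bdd_below by (auto simp: bounded_below_def)
  have mf: "m \<le> f (\<mu> (Suc n))" for n
    using m[OF JKO(1), of n] FD[OF \<mu>D, of n] by simp
  define B where "B = f (\<mu> (Suc 0)) - m"
  have B: "0 \<le> B" using mf[of 0] by (simp add: B_def)
  have "(MIN n\<in>{1..N}. dist_zero_subdiff \<F> (\<mu> n)) \<le> ereal (sqrt (2 * C * B + 1) * real N powr (-1/2))"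
    if N: "2 \<le> N" for N
  proof -
    \<comment> \<open>The iterates with indices 1 to \<open>N\<close> have \<open>N - 1\<close>
      decrements between them; \<open>i < N - 1\<close> guarantees that \<open>Suc (Suc i)\<close>
      is at most \<open>N\<close>.\<close>
    obtain i where i: "i < N - 1" "f (\<mu> (Suc i)) - f (\<mu> (Suc (Suc i))) \<le> B / real (N - 1)"
      using small_decrement[of m "\<lambda>n. f (\<mu> (Suc n))" "N - 1"] mf N unfolding B_def by auto
    have "B / real (N - 1) \<le> 2 * B / real N"
    proof -
      have "real N \<le> 2 * real (N - 1)" using N by simp
      then have "B * real N \<le> B * (2 * real (N - 1))" using B by (rule mult_left_mono)
      then show ?thesis using N by (simp add: divide_simps mult_ac)
    qed
    then have "C * (f (\<mu> (Suc i)) - f (\<mu> (Suc (Suc i)))) \<le> C * (2 * B / real N)"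
      using i(2) C by (intro mult_left_mono) auto
    \<comment> \<open>The added 1 makes the inequality strict even if \<open>B\<close> or
      \<open>C\<close> vanishes, as \<open>step\<close> demands.\<close>
    also have "\<dots> < (2 * C * B + 1) / real N"
      using N by (simp add: divide_simps)
    finally have "dist_zero_subdiff \<F> (\<mu> (Suc (Suc i))) \<le> ereal (sqrt ((2 * C * B + 1) / real N))"
      by (rule step)
    also have "sqrt ((2 * C * B + 1) / real N) = sqrt (2 * C * B + 1) * real N powr (-1/2)"
      using N by (simp add: real_sqrt_divide powr_minus_divide powr_half_sqrt)
    finally have "dist_zero_subdiff \<F> (\<mu> (Suc (Suc i))) \<le> ereal (sqrt (2 * C * B + 1) * real N powr (-1/2))" .
    moreover have "(MIN n\<in>{1..N}. dist_zero_subdiff \<F> (\<mu> n)) \<le> dist_zero_subdiff \<F> (\<mu> (Suc (Suc i)))"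
      using i(1) by (intro Min_le) auto
    ultimately show ?thesis by (rule order_trans[rotated])
  qed
  then show ?thesis
    by (intro exI[of _ "sqrt (2 * C * B + 1)"] eventually_sequentiallyI[of 2])
qed

end
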